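(* There is a computable tree $T\subseteq\omega^{<\omega}$ such that the structure $\mathcal{A}(T)$ has Scott rank $\omega_1^{CK}+1$.
   Context: A tree $T\subseteq\omega^{<\omega}$ is a set of finite sequences closed under initial segments. $\omega_1^{CK}$ is the least non-computable ordinal. The structure $\mathcal{A}(T)$. Let $T_n$ be the set of nodes at level $n$ of $T$. Let $G_n=\mathcal{P}_{<\omega}(T_n)$ be the collection of finite subsets of $T_n$, an abelian group under symmetric difference $\Delta$, with identity $\mathrm{id}_n$ (the empty set, regarded as an element of level $n$, so the $G_n$ are taken to be pairwise disjoint). Let $G=\bigcup_n G_n$. Define $p:G_{n+1}\to G_n$ as follows: if $a=\{t_1,\ldots,t_k\}\in G_{n+1}$, then $p(a)$ is the sum in $G_n$ of (the singletons of) the predecessors of $t_1,\ldots,t_k$; that is, $t^*\in p(a)$ iff the number of successors of $t^*$ in $a$ is odd. For each $a\in G$ define a unary function $f_a:G\to G$: if $a\in G_m$ and $b\in G_n$, let $k=\min(m,n)$ and $f_a(b)=p^{m-k}(a)\,\Delta\,p^{n-k}(b)\in G_k$. Then $\mathcal{A}(T)$ is the structure $(G,(f_a)_{a\in G})$, with one unary function symbol for each $a\in G$. Scott rank. For tuples $\bar a,\bar b$ of the same finite length in a structure $\mathcal{A}$: $\bar a\sim^0\bar b$ if $\bar a$ and $\bar b$ satisfy the same atomic formulas; for $\alpha>0$, $\bar a\sim^\alpha\bar b$ if for each $\beta<\alpha$, for each tuple $\bar c$ there exists $\bar d$, and for each $\bar d$ there exists $\bar c$, such that $\bar a,\bar c\sim^\beta\bar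 b,\bar d$. The Scott rank of a tuple $\bar a$ is the least $\alpha$ such that for all $\bar b$, if $\bar a\sim^\alpha\bar b$ then $\bar a\sim^\gamma\bar b$ for all $\gamma>\alpha$. The Scott rank of $\mathcal{A}$ is the least ordinal greater than the Scott ranks of all tuples in $\mathcal{A}$. *)

theory Defs
  imports Main "HOL-Library.Nat_Bijection" "HOL-Library.Sublist" "HOL-Library.Countable_Set"
begin

unbundle cardinal_syntax

section \<open>Ordinals\<close>

text \<open>
  An ordinal is an isomorphism class of well-orders whose field is a set of sets of natural numbers.
  This type consists of all ordinals of cardinality at most the continuum, so it contains all
  countable ordinals and also \<open>\<omega>\<^sub>1\<close>.  In a countable structure the relations \<open>\<sim>\<^sup>\<alpha>\<close> below no longer
  change from some countable \<open>\<alpha>\<close> on, so letting \<open>\<alpha>\<close> and \<open>\<gamma>\<close> range over this type loses nothing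
  (see \<open>back_forth_stable\<close> and \<open>back_forth_stabilises\<close>).
\<close>

quotient_type ordinal = "nat set rel" / partial: "\<lambda>r s. r =o s"
proof (rule part_equivpI)
  show "\<exists>r :: nat set rel. r =o r"
    using card_of_Well_order ordIso_reflexive by blast
  show "symp (\<lambda>r s :: nat set rel. r =o s)"
    by (rule sympI) (rule ordIso_symmetric)
  show "transp (\<lambda>r s :: nat set rel. r =o s)"
    by (rule transpI) (rule ordIso_transitive)
qed

text \<open>Here \<open>r\<close> may be a well-order on any type.\<close>

lift_definition has_order_type :: "'a rel \<Rightarrow> ordinal \<Rightarrow> bool" is "\<lambda>r s. r =o s"
  by (metis ordIso_symmetric ordIso_transitive)

instantiation ordinal :: "{zero, linorder}"
begin

lift_definition zero_ordinal :: ordinal is "{}"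
  by (rule ordIso_reflexive) simp

lift_definition less_eq_ordinal :: "ordinal \<Rightarrow> ordinal \<Rightarrow> bool" is "\<lambda>r s. r \<le>o s"
  by (meson ordIso_ordLeq_trans ordIso_symmetric ordLeq_ordIso_trans)

lift_definition less_ordinal :: "ordinal \<Rightarrow> ordinal \<Rightarrow> bool" is "\<lambda>r s. r <o s"
  by (meson ordIso_ordLess_trans ordIso_symmetric ordLess_ordIso_trans)

instance
proof
  fix \<alpha> \<beta> \<gamma> :: ordinal
  show "(\<alpha> < \<beta>) = (\<alpha> \<le> \<beta> \<and> \<not> \<beta> \<le> \<alpha>)"
    by transfer
      (metis not_ordLess_ordLeq ordIso_iff_ordLeq ordLeq_Well_order_simp ordLess_imp_ordLeq
        ordLess_or_ordLeq)
  show "\<alpha> \<le> \<alpha>"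
    by transfer (rule ordIso_imp_ordLeq)
  show "\<alpha> \<le> \<beta> \<Longrightarrow> \<beta> \<le> \<gamma> \<Longrightarrow> \<alpha> \<le> \<gamma>"
    by transfer (rule ordLeq_transitive)
  show "\<alpha> \<le> \<beta> \<Longrightarrow> \<beta> \<le> \<alpha> \<Longrightarrow> \<alpha> = \<beta>"
    by transfer (simp add: ordIso_iff_ordLeq)
  show "\<alpha> \<le> \<beta> \<or> \<beta> \<le> \<alpha>"
    by transfer (metis ordIso_iff_ordLeq ordLeq_Well_order_simp ordLeq_total)
qed

end

lemma wf_ordinal: "wf {(\<alpha>, \<beta> :: ordinal). \<alpha> < \<beta>}"
proof -
  have "{(\<alpha>, \<beta>). \<alpha> < \<beta>} \<subseteq> inv_image ordLess rep_ordinal"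
    by (auto simp: less_ordinal_def)
  then show ?thesis
    using wf_inv_image[OF wf_ordLess] wf_subset by blast
qed

instance ordinal :: wellorder
proof
  fix P :: "ordinal \<Rightarrow> bool" and \<alpha> :: ordinal
  assume step: "\<And>\<beta>. (\<And>\<gamma>. \<gamma> < \<beta> \<Longrightarrow> P \<gamma>) \<Longrightarrow> P \<beta>"
  from wf_ordinal show "P \<alpha>"
    by (induction \<alpha> rule: wf_induct_rule) (auto intro: step)
qed

definition ordinal_suc :: "ordinal \<Rightarrow> ordinal" where
  "ordinal_suc \<alpha> = (LEAST \<beta>. \<alpha> < \<beta>)"

lemma Well_order_rep: "Well_order (rep_ordinal \<alpha>)"
  using Quotient_rep_reflp[OF Quotient_ordinal, of \<alpha>] by (simp add: ordIso_def)

lemma abs_less: "Well_order r \<Longrightarrow> Well_order s \<Longrightarrow> (abs_ordinal r < abs_ordinal s) = (r <o s)"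
  by (simp add: less_ordinal.abs_eq ordIso_reflexive)

lemma zero_le_ordinal: "(0 :: ordinal) \<le> \<alpha>"
proof -
  have "\<not> rep_ordinal \<alpha> <o ({} :: nat set rel)"
    using ordLess_iff_ordIso_Restr[of "{} :: nat set rel", OF _ Well_order_rep] by auto
  then have "\<not> abs_ordinal (rep_ordinal \<alpha>) < 0"
    by (simp add: abs_less Well_order_rep zero_ordinal_def)
  then show ?thesis by (simp add: Quotient_abs_rep[OF Quotient_ordinal] not_less)
qed

lemma less_ordinal_suc: "\<alpha> < ordinal_suc \<alpha>"
proof -
  define f :: "nat set \<Rightarrow> nat set" where "f X = insert 0 (Suc ` X)" for X
  define r where "r = rep_ordinal \<alpha>"
  define s where "s = dir_image r f"
  define t where "t = s \<union> (\<lambda>x. (x, {})) ` insert {} (Field s)"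
  have r: "Well_order r" by (simp add: r_def Well_order_rep)
  have inj: "inj f" by (rule injI) (auto simp: f_def)
  have rs: "r =o s" unfolding s_def using r inj by (intro dir_image_ordIso) (auto intro: inj_on_subset)
  have s: "Well_order s" using rs by (simp add: ordIso_def)
  have nin: "{} \<notin> Field s" by (auto simp: s_def dir_image_Field f_def)
  then have nin2: "({}, x) \<notin> s" "(x, {}) \<notin> s" for x by (auto simp: Field_def)
  have Ft: "Field t = insert {} (Field s)" by (auto simp: t_def Field_def)
  have t: "Well_order t" unfolding well_order_on_def linear_order_on_def partial_order_on_def preorder_on_def
  proof (intro conjI)
    note ss = s[unfolded well_order_on_def linear_order_on_def partial_order_on_def preorder_on_def]
    show "t \<subseteq> Field t \<times> Field t" by (auto simp: Field_def)
    show "Refl t" using ss by (auto simp: refl_on_def Ft) (auto simp: t_def)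
    show "trans t" using ss nin2 unfolding t_def trans_def Field_def by blast
    show "antisym t" using ss nin2 unfolding antisym_def by (auto simp: t_def Field_def)
    show "Total t" using ss unfolding total_on_def by (auto simp: Ft) (auto simp: t_def)
    have "wf ((s - Id) \<union> (\<lambda>x. (x, {})) ` Field s)"
    proof (rule wf_Un)
      show "wf (s - Id)" using ss by blast
      show "wf ((\<lambda>x. (x, {})) ` Field s)" 
        by (rule wf_subset[OF wf_measure[of "\<lambda>X. if X = {} then 1 else 0"]]) (use nin in auto)
      show "Domain (s - Id) \<inter> Range ((\<lambda>x. (x, {})) ` Field s) = {}" using nin2 by auto
    qed
    then show "wf (t - Id)" by (rule wf_subset) (auto simp: t_def)
  qed
  have u: "underS t {} = Field s" using nin nin2 by (auto simp: underS_def t_def)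
  have "Restr t (Field s) = s" using nin by (auto simp: t_def Field_def)
  then have "s <o t" using underS_Restr_ordLess[OF t, of "{}"] Ft by (simp add: u)
  then have "r <o t" using rs ordIso_ordLess_trans by blast
  then have "\<alpha> < abs_ordinal t"
    using abs_less[OF r t] Quotient_abs_rep[OF Quotient_ordinal, of \<alpha>] by (simp add: r_def)
  then show ?thesis unfolding ordinal_suc_def by (rule LeastI)
qed

lemma uncountable_ordinal: "uncountable (UNIV :: ordinal set)"
proof
  let ?r = "card_of (UNIV :: nat set set)"
  define h where "h x = abs_ordinal (Restr ?r (underS ?r x))" for x
  have r: "Well_order ?r" by (rule card_of_Well_order)
  have F: "Field ?r = UNIV" by (simp add: Field_card_of)
  have R: "Well_order (Restr ?r (underS ?r x))" for x using r by (rule Well_order_Restr)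
  have less: "h x < h y" if xy: "(x, y) \<in> ?r" "x \<noteq> y" for x y
  proof -
    have w: "wo_rel ?r" using r by (simp add: wo_rel_def)
    have "(y, x) \<notin> ?r" using xy r
      by (auto simp: well_order_on_def linear_order_on_def partial_order_on_def antisym_def)
    then have "x \<in> underS ?r y" "x \<notin> underS ?r x" "underS ?r x \<subseteq> underS ?r y" using xy r
      by (auto simp: underS_def well_order_on_def linear_order_on_def partial_order_on_def
          preorder_on_def elim: transE)
    then have "underS ?r x \<subset> underS ?r y" by blast
    then have "Restr ?r (underS ?r x) <o Restr ?r (underS ?r y)"
      using ofilter_subset_ordLess[OF r wo_rel.underS_ofilter[OF w] wo_rel.underS_ofilter[OF w]] by blast
    then show ?thesis unfolding h_def using abs_less[OF R R] by simp
  qed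
  have "inj h"
  proof (rule injI, rule ccontr)
    fix x y assume "h x = h y" "x \<noteq> y"
    then show False using less[of x y] less[of y x] r F
      by (auto simp: well_order_on_def linear_order_on_def total_on_def)
  qed
  moreover assume "countable (UNIV :: ordinal set)"
  ultimately have "countable (UNIV :: nat set set)"
    by (metis countable_image_inj_on countable_subset subset_UNIV)
  then obtain g :: "nat set \<Rightarrow> nat" where "inj g" unfolding countable_def by blast
  then have "surj (inv g)" by (rule inj_imp_surj_inv)
  then show False using Cantors_theorem by (metis Pow_UNIV)
qed

section \<open>Computability\<close>

text \<open>
  Partial recursive functions on argument tuples of natural numbers.  Arities are not enforced:
  for instance \<open>Zero_fn\<close> is the constant 0 on tuples of every length.
\<close>

datatype recf = Zero_fn | Suc_fn | Proj_fn nat | Comp_fn recf "recf list" | Prec_fn recf recf | Mu_fn recf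

inductive evaluates :: "recf \<Rightarrow> nat list \<Rightarrow> nat \<Rightarrow> bool" where
  Zero: "evaluates Zero_fn xs 0"
| Suc: "evaluates Suc_fn [x] (Suc x)"
| Proj: "i < length xs \<Longrightarrow> evaluates (Proj_fn i) xs (xs ! i)"
| Comp: "list_all2 (\<lambda>g y. evaluates g xs y) gs ys \<Longrightarrow> evaluates f ys z
    \<Longrightarrow> evaluates (Comp_fn f gs) xs z"
| Prec_0: "evaluates f xs y \<Longrightarrow> evaluates (Prec_fn f g) (0 # xs) y"
| Prec_Suc: "evaluates (Prec_fn f g) (n # xs) y \<Longrightarrow> evaluates g (n # y # xs) z
    \<Longrightarrow> evaluates (Prec_fn f g) (Suc n # xs) z"
| Mu: "evaluates f (n # xs) 0 \<Longrightarrow> (\<forall>m<n. \<exists>y>0. evaluates f (m # xs) y)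
    \<Longrightarrow> evaluates (Mu_fn f) xs n"

definition computable_set :: "nat set \<Rightarrow> bool" where
  "computable_set A \<longleftrightarrow> (\<exists>f. \<forall>n. evaluates f [n] (if n \<in> A then 1 else 0))"

text \<open>
  The field of a computable reflexive relation \<open>r\<close> is computable, so these are the order types of
  computable well-orders of computable sets of natural numbers; finite ordinals are included.
\<close>

definition computable_ordinal :: "ordinal \<Rightarrow> bool" where
  "computable_ordinal \<alpha> \<longleftrightarrow>
    (\<exists>r :: nat rel. Well_order r \<and> computable_set (prod_encode ` r) \<and> has_order_type r \<alpha>)"

definition omega1_CK :: ordinal where
  "omega1_CK = (LEAST \<alpha>. \<not> computable_ordinal \<alpha>)"

lemma ex_not_computable_ordinal: "\<exists>\<alpha>. \<not> computable_ordinal \<alpha>"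
proof -
  let ?r = "card_of (UNIV :: nat set set)"
  have "\<not> s =o ?r" for s :: "nat rel"
  proof
    assume "s =o ?r"
    then obtain f where "bij_betw f (Field s) (UNIV :: nat set set)"
      by (auto simp: ordIso_def iso_def Field_card_of)
    then have "f ` Field s = UNIV" by (simp add: bij_betw_def)
    then have "range f = UNIV" by blast
    then show False using Cantors_theorem by (metis Pow_UNIV)
  qed
  then have "\<not> computable_ordinal (abs_ordinal ?r)"
    by (simp add: computable_ordinal_def has_order_type.abs_eq ordIso_reflexive card_of_Well_order)
  then show ?thesis ..
qed

section \<open>Scott rank\<close>

text \<open>A structure for a language of unary function symbols, which are the elements of \<open>symbols\<close>.\<close>

record ('i, 'a) unary_structure =
  universe :: "'a set"
  symbols :: "'i set"
  interp :: "'i \<Rightarrow> 'a \<Rightarrow> 'a"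

datatype 'i unary_term = Var nat | App 'i "'i unary_term"

fun term_val :: "('i, 'a) unary_structure \<Rightarrow> 'a list \<Rightarrow> 'i unary_term \<Rightarrow> 'a" where
  "term_val M xs (Var i) = xs ! i"
| "term_val M xs (App f t) = interp M f (term_val M xs t)"

inductive_set terms :: "('i, 'a) unary_structure \<Rightarrow> nat \<Rightarrow> 'i unary_term set"
  for M :: "('i, 'a) unary_structure" and n :: nat where
  "i < n \<Longrightarrow> Var i \<in> terms M n"
| "f \<in> symbols M \<Longrightarrow> t \<in> terms M n \<Longrightarrow> App f t \<in> terms M n"

abbreviation tuples :: "('i, 'a) unary_structure \<Rightarrow> 'a list set" where
  "tuples M \<equiv> lists (universe M)"

text \<open>The language has no relation symbols, so the atomic formulas are the equations \<open>s = t\<close>.\<close>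

definition same_atomic :: "('i, 'a) unary_structure \<Rightarrow> 'a list \<Rightarrow> 'a list \<Rightarrow> bool" where
  "same_atomic M xs ys \<longleftrightarrow> length xs = length ys \<and>
    (\<forall>s \<in> terms M (length xs). \<forall>t \<in> terms M (length xs).
      term_val M xs s = term_val M xs t \<longleftrightarrow> term_val M ys s = term_val M ys t)"

function back_forth ::
  "('i, 'a) unary_structure \<Rightarrow> ordinal \<Rightarrow> 'a list \<Rightarrow> 'a list \<Rightarrow> bool" where
  "back_forth M \<alpha> xs ys \<longleftrightarrow>
    (if \<alpha> = 0 then same_atomic M xs ys
     else \<forall>\<beta><\<alpha>.
       (\<forall>zs \<in> tuples M. \<exists>ws \<in> tuples M. length ws = length zs \<and> back_forth M \<beta> (xs @ zs) (ys @ ws)) \<and>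
       (\<forall>ws \<in> tuples M. \<exists>zs \<in> tuples M. length zs = length ws \<and> back_forth M \<beta> (xs @ zs) (ys @ ws)))"
  by auto
termination
  by (relation "inv_image {(\<alpha>, \<beta>). \<alpha> < \<beta>} (\<lambda>(M, \<alpha>, xs, ys). \<alpha>)") (auto simp: wf_ordinal)

declare back_forth.simps [simp del]

lemma back_forth_pos:
  assumes "\<alpha> > 0"
  shows "back_forth M \<alpha> xs ys \<longleftrightarrow> (\<forall>\<beta><\<alpha>.
    (\<forall>zs \<in> tuples M. \<exists>ws \<in> tuples M. length ws = length zs \<and> back_forth M \<beta> (xs @ zs) (ys @ ws)) \<and>
    (\<forall>ws \<in> tuples M. \<exists>zs \<in> tuples M. length zs = length ws \<and> back_forth M \<beta> (xs @ zs) (ys @ ws)))"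
  using assms by (subst (1) back_forth.simps) (rule if_not_P, auto)

lemma back_forth_antimono:
  fixes M :: "('i, 'a) unary_structure"
  assumes "\<alpha> \<le> \<beta>" "back_forth M \<beta> xs ys"
  shows "back_forth M \<alpha> xs ys"
proof (cases "\<alpha> = \<beta>")
  case False
  then have lt: "\<alpha> < \<beta>" using assms by simp
  then have "\<beta> > 0" using zero_le_ordinal[of \<alpha>] by (rule le_less_trans[rotated])
  from assms(2)[unfolded back_forth_pos[OF this]] lt
  have "\<forall>zs \<in> tuples M. \<exists>ws \<in> tuples M. length ws = length zs \<and> back_forth M \<alpha> (xs @ zs) (ys @ ws)"
    by blast
  from bspec[OF this, of "[]"]
  have "\<exists>ws \<in> tuples M. length ws = length ([] :: 'a list) \<and> back_forth M \<alpha> (xs @ []) (ys @ ws)"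
    by blast
  then show ?thesis by auto
qed (use assms in simp)

lemma back_forth_stable:
  assumes stable: "\<And>xs ys. xs \<in> tuples M \<Longrightarrow> ys \<in> tuples M \<Longrightarrow> back_forth M \<alpha> xs ys \<Longrightarrow>
      back_forth M (ordinal_suc \<alpha>) xs ys"
    and "xs \<in> tuples M" "ys \<in> tuples M" "back_forth M \<alpha> xs ys"
  shows "back_forth M \<gamma> xs ys"
  using assms(2-)
proof (induction \<gamma> arbitrary: xs ys rule: less_induct)
  case (less \<gamma>)
  show ?case
  proof (cases "\<gamma> = 0")
    case True
    then show ?thesis using less.prems(3) back_forth_antimono zero_le_ordinal by blast
  next
    case False
    then have pos: "\<gamma> > 0" using zero_le_ordinal[of \<gamma>] by (simp add: order.strict_iff_order)
    have suc_pos: "ordinal_suc \<alpha> > 0"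
      using le_less_trans[OF zero_le_ordinal less_ordinal_suc] .
    have IH: "back_forth M \<beta> (xs @ zs) (ys @ ws)"
      if "\<beta> < \<gamma>" "zs \<in> tuples M" "ws \<in> tuples M" "back_forth M \<alpha> (xs @ zs) (ys @ ws)" for \<beta> zs ws
    proof (rule less.IH[OF that(1) _ _ that(4)])
      show "xs @ zs \<in> tuples M" "ys @ ws \<in> tuples M"
        using that(2,3) less.prems(1,2) by (auto simp: append_in_lists_conv)
    qed
    have "back_forth M (ordinal_suc \<alpha>) xs ys" using stable[OF less.prems] .
    then have
      "(\<forall>zs \<in> tuples M. \<exists>ws \<in> tuples M. length ws = length zs \<and> back_forth M \<alpha> (xs @ zs) (ys @ ws)) \<and>
       (\<forall>ws \<in> tuples M. \<exists>zs \<in> tuples M. length zs = length ws \<and> back_forth M \<alpha> (xs @ zs) (ys @ ws))"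
      unfolding back_forth_pos[OF suc_pos] using less_ordinal_suc by blast
    then show ?thesis
      unfolding back_forth_pos[OF pos] using IH by meson
  qed
qed

lemma back_forth_stabilises:
  assumes "countable (universe M)"
  shows "\<exists>\<alpha>. \<forall>xs \<in> tuples M. \<forall>ys \<in> tuples M. back_forth M \<alpha> xs ys \<longrightarrow> (\<forall>\<gamma>. back_forth M \<gamma> xs ys)"
proof (rule ccontr)
  assume c: "\<not> ?thesis"
  have "\<exists>xs ys. xs \<in> tuples M \<and> ys \<in> tuples M \<and> back_forth M \<alpha> xs ys \<and>
      \<not> back_forth M (ordinal_suc \<alpha>) xs ys" for \<alpha>
    using c back_forth_stable[of M \<alpha>] by blast
  then obtain f g where fg: "\<And>\<alpha>. f \<alpha> \<in> tuples M" "\<And>\<alpha>. g \<alpha> \<in> tuples M"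
      "\<And>\<alpha>. back_forth M \<alpha> (f \<alpha>) (g \<alpha>)" "\<And>\<alpha>. \<not> back_forth M (ordinal_suc \<alpha>) (f \<alpha>) (g \<alpha>)"
    by metis
  have ne: "(f \<alpha>, g \<alpha>) \<noteq> (f \<beta>, g \<beta>)" if "\<alpha> < \<beta>" for \<alpha> \<beta>
  proof -
    have "ordinal_suc \<alpha> \<le> \<beta>" unfolding ordinal_suc_def using that by (rule Least_le)
    then have "\<not> back_forth M \<beta> (f \<alpha>) (g \<alpha>)" using fg(4) back_forth_antimono by blast
    then show ?thesis using fg(3)[of \<beta>] by auto
  qed
  then have "inj (\<lambda>\<alpha>. (f \<alpha>, g \<alpha>))" by (intro injI) (use ne linorder_neqE in blast)
  moreover have "range (\<lambda>\<alpha>. (f \<alpha>, g \<alpha>)) \<subseteq> tuples M \<times> tuples M" using fg by auto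
  moreover have "countable (tuples M \<times> tuples M)" using assms by simp
  ultimately have "countable (UNIV :: ordinal set)"
    by (blast intro: countable_image_inj_on[of "\<lambda>\<alpha>. (f \<alpha>, g \<alpha>)"] countable_subset)
  then show False using uncountable_ordinal by blast
qed

definition tuple_rank :: "('i, 'a) unary_structure \<Rightarrow> 'a list \<Rightarrow> ordinal" where
  "tuple_rank M xs = (LEAST \<alpha>. \<forall>ys \<in> tuples M. length ys = length xs \<longrightarrow>
     back_forth M \<alpha> xs ys \<longrightarrow> (\<forall>\<gamma>>\<alpha>. back_forth M \<gamma> xs ys))"

definition scott_rank :: "('i, 'a) unary_structure \<Rightarrow> ordinal" where
  "scott_rank M = (LEAST \<alpha>. \<forall>xs \<in> tuples M. tuple_rank M xs < \<alpha>)"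

section \<open>The structure of a tree\<close>

definition is_tree :: "nat list set \<Rightarrow> bool" where
  "is_tree T \<longleftrightarrow> (\<forall>t \<in> T. \<forall>s. prefix s t \<longrightarrow> s \<in> T)"

definition computable_tree :: "nat list set \<Rightarrow> bool" where
  "computable_tree T \<longleftrightarrow> is_tree T \<and> computable_set (list_encode ` T)"

definition level :: "nat list set \<Rightarrow> nat \<Rightarrow> nat list set" where
  "level T n = {t \<in> T. length t = n}"

text \<open>
  Elements of \<open>G\<^sub>n\<close> are tagged with \<open>n\<close>, which makes the groups \<open>G\<^sub>n\<close> pairwise disjoint.
\<close>

definition tree_group :: "nat list set \<Rightarrow> (nat \<times> nat list set) set" where
  "tree_group T = {(n, a). finite a \<and> a \<subseteq> level T n}"

text \<open>
  The map \<open>p\<close> on untagged finite sets; for \<open>a \<subseteq> T\<^sub>n\<^sub>+\<^sub>1\<close> with \<open>T\<close> a tree, the result is a subset of \<open>T\<^sub>n\<close>.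
\<close>

definition parent_sum :: "nat list set \<Rightarrow> nat list set" where
  "parent_sum a = {s. odd (card {t \<in> a. \<exists>x. t = s @ [x]})}"

definition tree_fun :: "nat \<times> nat list set \<Rightarrow> nat \<times> nat list set \<Rightarrow> nat \<times> nat list set" where
  "tree_fun = (\<lambda>(m, a) (n, b). let k = min m n in
     (k, sym_diff ((parent_sum ^^ (m - k)) a) ((parent_sum ^^ (n - k)) b)))"

definition tree_structure ::
  "nat list set \<Rightarrow> (nat \<times> nat list set, nat \<times> nat list set) unary_structure" where
  "tree_structure T = \<lparr>universe = tree_group T, symbols = tree_group T, interp = tree_fun\<rparr>"

end

(*
  The automorphisms of A(T) are the translations by coherent sequences, i.e. by infinite paths of the
  tree (G, p), and two tuples whose highest level is n can only be related by a translation by some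
  g in G_n.  They are related by ~^alpha iff every node of g has tree rank at least omega * alpha.
  Hence the Scott rank of a tuple is the supremum of the (coarsened) ranks of the well-founded nodes
  on its highest level.  In a computable tree these are below omega_1^CK, by the Kleene-Brouwer order
  of the subtree above the node.  So it suffices that the ranks on level 1 are cofinal in
  omega_1^CK.  To achieve this, put above the node <e> the descending sequences of the relation
  computed by program e.  Every step of such a sequence carries a certificate for the computation
  that justifies it, and so membership in the tree is decidable although e may be a partial program.
*)

theory Submission
  imports Defs
begin

section \<open>Computable functions\<close>

text \<open>Whether a program computes a well-order is not decidable, so the tree has to offer a
  subtree to every number e. The bad ones are harmless: a node of a computable tree is either
  well-founded, and then its rank is below omega_1^CK, or ill-founded, and then it has every rank.
  So stages past omega_1^CK separate nothing, which gives the upper bound. The value is omega_1^CK +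
  1 rather than omega_1^CK because one single level carries the cofinal ranks: the tuple consisting
  of the identity of that level then has rank exactly omega_1^CK. The factor omega comes from the
  definition of ~^\<alpha>: one stage adds a whole tuple, whose entries may lie on any higher level,
  so one stage looks past any finite number of levels. The tree of descending sequences has to be
  stretched to match.\<close>

definition computable_fun :: "(nat \<Rightarrow> nat) \<Rightarrow> bool" where
  "computable_fun F \<longleftrightarrow> (\<exists>f. \<forall>x. evaluates f [x] (F x))"

definition decidable :: "(nat \<Rightarrow> bool) \<Rightarrow> bool" where
  "decidable P \<longleftrightarrow> computable_fun (\<lambda>x. if P x then 1 else 0)"

lemma computable_set_iff_decidable: "computable_set A \<longleftrightarrow> decidable (\<lambda>x. x \<in> A)"
  by (simp add: computable_set_def decidable_def computable_fun_def)

named_theorems computable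

lemma evaluates_Proj: "i < length xs \<Longrightarrow> y = xs ! i \<Longrightarrow> evaluates (Proj_fn i) xs y"
  by (simp add: evaluates.Proj)

lemma evaluates_Comp1:
  "evaluates g xs y \<Longrightarrow> evaluates f [y] z \<Longrightarrow> evaluates (Comp_fn f [g]) xs z"
  by (rule evaluates.Comp[where ys = "[y]"]) auto

lemma evaluates_Comp2:
  "evaluates g xs y \<Longrightarrow> evaluates h xs y' \<Longrightarrow> evaluates f [y, y'] z
    \<Longrightarrow> evaluates (Comp_fn f [g, h]) xs z"
  by (rule evaluates.Comp[where ys = "[y, y']"]) auto

lemma computable_fun_ident [computable]: "computable_fun (\<lambda>x. x)"
  unfolding computable_fun_def by (rule exI[of _ "Proj_fn 0"]) (simp add: evaluates_Proj)

lemma computable_fun_comp: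
  "computable_fun F \<Longrightarrow> computable_fun G \<Longrightarrow> computable_fun (\<lambda>x. F (G x))"
  unfolding computable_fun_def by (meson evaluates_Comp1)

lemma computable_fun_Suc [computable]: "computable_fun F \<Longrightarrow> computable_fun (\<lambda>x. Suc (F x))"
  by (rule computable_fun_comp[of Suc]) (auto simp: computable_fun_def intro: evaluates.Suc)

lemma computable_fun_const [computable]: "computable_fun (\<lambda>x. c)"
proof (induction c)
  case 0
  show ?case unfolding computable_fun_def using evaluates.Zero by blast
qed (rule computable_fun_Suc)

definition computable_fun2 :: "(nat \<Rightarrow> nat \<Rightarrow> nat) \<Rightarrow> bool" where
  "computable_fun2 F \<longleftrightarrow> (\<exists>f. \<forall>x y. evaluates f [x, y] (F x y))"

lemma computable_fun2_comp:
  "computable_fun2 F \<Longrightarrow> computable_fun G \<Longrightarrow> computable_fun H \<Longrightarrow> computable_fun (\<lambda>x. F (G x) (H x))"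
  unfolding computable_fun_def computable_fun2_def by (meson evaluates_Comp2)

section \<open>Programs for arithmetic and for the Cantor pairing function\<close>

definition plus_fn :: recf where
  "plus_fn = Prec_fn (Proj_fn 0) (Comp_fn Suc_fn [Proj_fn 1])"

lemma evaluates_plus: "evaluates plus_fn [n, m] (n + m)"
proof (induction n)
  case 0
  show ?case unfolding plus_fn_def by (auto intro!: evaluates.Prec_0 evaluates_Proj)
next
  case (Suc n)
  show ?case unfolding plus_fn_def
    by (rule evaluates.Prec_Suc[OF Suc[unfolded plus_fn_def]])
      (auto intro!: evaluates_Comp1 evaluates_Proj evaluates.Suc)
qed

definition pred_fn :: recf where "pred_fn = Prec_fn Zero_fn (Proj_fn 0)"

lemma evaluates_pred: "evaluates pred_fn [n] (n - 1)"
proof (induction n)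
  case 0
  show ?case unfolding pred_fn_def by (auto intro!: evaluates.Prec_0 evaluates.Zero)
next
  case (Suc n)
  show ?case unfolding pred_fn_def
    by (rule evaluates.Prec_Suc[OF Suc[unfolded pred_fn_def]]) (auto intro!: evaluates_Proj)
qed

text \<open>\<open>Prec_fn\<close> recurses on the first argument, so the subtrahend has to come
  first.\<close>

definition minus_fn :: recf where
  "minus_fn = Prec_fn (Proj_fn 0) (Comp_fn pred_fn [Proj_fn 1])"

lemma evaluates_minus: "evaluates minus_fn [n, m] (m - n)"
proof (induction n)
  case 0
  show ?case unfolding minus_fn_def by (auto intro!: evaluates.Prec_0 evaluates_Proj)
next
  case (Suc n)
  have "m - Suc n = m - n - 1" by simp
  then show ?case unfolding minus_fn_def
    by (intro evaluates.Prec_Suc[OF Suc[unfolded minus_fn_def]])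
      (auto intro!: evaluates_Comp1 evaluates_Proj evaluates_pred[of "m - n", simplified])
qed

definition times_fn :: recf where
  "times_fn = Prec_fn Zero_fn (Comp_fn plus_fn [Proj_fn 1, Proj_fn 2])"

lemma evaluates_times: "evaluates times_fn [n, m] (n * m)"
proof (induction n)
  case 0
  show ?case unfolding times_fn_def by (auto intro!: evaluates.Prec_0 evaluates.Zero)
next
  case (Suc n)
  have "evaluates plus_fn [n * m, m] (Suc n * m)" using evaluates_plus[of "n * m" m]
    by (simp add: add.commute)
  then show ?case unfolding times_fn_def
    by (intro evaluates.Prec_Suc[OF Suc[unfolded times_fn_def]])
      (auto intro!: evaluates_Comp2 evaluates_Proj)
qed

definition triangle_fn :: recf where
  "triangle_fn = Prec_fn Zero_fn (Comp_fn plus_fn [Proj_fn 1, Comp_fn Suc_fn [Proj_fn 0]])"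

lemma evaluates_triangle: "evaluates triangle_fn [n] (triangle n)"
proof (induction n)
  case 0
  show ?case unfolding triangle_fn_def by (auto intro!: evaluates.Prec_0 evaluates.Zero)
next
  case (Suc n)
  show ?case unfolding triangle_fn_def
    by (rule evaluates.Prec_Suc[OF Suc[unfolded triangle_fn_def]])
      (auto intro!: evaluates_Comp2[where y = "triangle n" and y' = "Suc n"] evaluates_Comp1
        evaluates_Proj evaluates.Suc evaluates_plus[of "triangle n" "Suc n", simplified])
qed

lemma computable_fun_plus [computable]:
  "computable_fun F \<Longrightarrow> computable_fun G \<Longrightarrow> computable_fun (\<lambda>x. F x + G x)"
  by (rule computable_fun2_comp) (auto simp: computable_fun2_def intro: evaluates_plus)

lemma computable_fun_minus [computable]:
  "computable_fun F \<Longrightarrow> computable_fun G \<Longrightarrow> computable_fun (\<lambda>x. F x - G x)"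
  by (rule computable_fun2_comp[of "\<lambda>y x. x - y"])
    (auto simp: computable_fun2_def intro: evaluates_minus)

lemma computable_fun_times [computable]:
  "computable_fun F \<Longrightarrow> computable_fun G \<Longrightarrow> computable_fun (\<lambda>x. F x * G x)"
  by (rule computable_fun2_comp) (auto simp: computable_fun2_def intro: evaluates_times)

lemma computable_fun_triangle [computable]:
  "computable_fun F \<Longrightarrow> computable_fun (\<lambda>x. triangle (F x))"
  by (rule computable_fun_comp) (auto simp: computable_fun_def intro: evaluates_triangle)

definition pair_fn :: recf where
  "pair_fn = Comp_fn plus_fn
    [Comp_fn triangle_fn [Comp_fn plus_fn [Proj_fn 0, Proj_fn 1]], Proj_fn 0]"

lemma evaluates_pair: "evaluates pair_fn [n, m] (prod_encode (n, m))"
  unfolding pair_fn_def prod_encode_def prod.case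
  by (rule evaluates_plus evaluates_triangle evaluates_Comp2 evaluates_Comp1 evaluates_Proj | simp)+

lemma computable_fun_prod_encode [computable]:
  "computable_fun F \<Longrightarrow> computable_fun G \<Longrightarrow> computable_fun (\<lambda>x. prod_encode (F x, G x))"
  by (rule computable_fun2_comp[of "\<lambda>x y. prod_encode (x, y)"])
    (auto simp: computable_fun2_def intro: evaluates_pair)

lemma computable_fun2_curry:
  "computable_fun (\<lambda>z. F (fst (prod_decode z)) (snd (prod_decode z))) \<Longrightarrow> computable_fun2 F"
  unfolding computable_fun_def computable_fun2_def
  by (metis evaluates_Comp1 evaluates_pair prod_encode_inverse fst_conv snd_conv)

definition nfst :: "nat \<Rightarrow> nat" where "nfst z = fst (prod_decode z)"
definition nsnd :: "nat \<Rightarrow> nat" where "nsnd z = snd (prod_decode z)"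

lemma nfst_prod_encode [simp]: "nfst (prod_encode (x, y)) = x"
  by (simp add: nfst_def)

lemma nsnd_prod_encode [simp]: "nsnd (prod_encode (x, y)) = y"
  by (simp add: nsnd_def)

lemma prod_encode_nfst_nsnd [simp]: "prod_encode (nfst z, nsnd z) = z"
  by (simp add: nfst_def nsnd_def)

text \<open>Makes \<open>ctl\<close> fix 0, the code of the empty list, so that dropping too many
  entries stays at 0.\<close>

lemma nsnd_0 [simp]: "nsnd 0 = 0"
  by (simp add: nsnd_def prod_decode_def prod_decode_aux.simps)

section \<open>Unbounded search and the inverse of the pairing function\<close>

lemma computable_fun_Least2:
  assumes f: "\<And>x i. evaluates f [i, x] (F x i)" and ex: "\<And>x. \<exists>i. F x i = 0"
  shows "computable_fun (\<lambda>x. LEAST i. F x i = 0)"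
proof -
  have "evaluates (Mu_fn f) [x] (LEAST i. F x i = 0)" for x
  proof (rule evaluates.Mu)
    show "evaluates f [LEAST i. F x i = 0, x] 0"
      using f[of "LEAST i. F x i = 0" x] LeastI_ex[OF ex[of x]] by simp
    show "\<forall>m<LEAST i. F x i = 0. \<exists>y>0. evaluates f [m, x] y"
      using f[of _ x] not_less_Least[of _ "\<lambda>i. F x i = 0"] by (metis neq0_conv)
  qed
  then show ?thesis unfolding computable_fun_def by blast
qed

lemma triangle_mono: "m \<le> n \<Longrightarrow> triangle m \<le> triangle n"
  by (induction rule: dec_induct) auto

lemma triangle_nfst_nsnd: "triangle (nfst z + nsnd z) + nfst z = z"
  using prod_encode_nfst_nsnd[of z] unfolding prod_encode_def by simp

text \<open>The pair \<open>(n, m)\<close> lies on the diagonal with number \<open>n + m\<close>.\<close>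

lemma diagonal_eq_Least:
  "nfst z + nsnd z = (LEAST k. Suc z - triangle (Suc k) = 0)" (is "_ = ?k")
proof (rule Least_equality[symmetric])
  note z = triangle_nfst_nsnd[of z]
  then show "Suc z - triangle (Suc (nfst z + nsnd z)) = 0" by simp
  fix k assume k: "Suc z - triangle (Suc k) = 0"
  show "nfst z + nsnd z \<le> k"
  proof (rule ccontr)
    assume "\<not> ?thesis"
    then have "triangle (Suc k) \<le> triangle (nfst z + nsnd z)" by (intro triangle_mono) simp
    with z k show False by linarith
  qed
qed

text \<open>Unpairing by search: the truncated difference \<open>Suc z - triangle (Suc k)\<close> is
  0 exactly when z lies below \<open>triangle (Suc k)\<close>, and k = z always qualifies. Both
  projections then follow by subtraction.\<close>

lemma computable_fun_diagonal: "computable_fun (\<lambda>z. nfst z + nsnd z)"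
proof -
  let ?f = "Comp_fn minus_fn [Comp_fn triangle_fn [Comp_fn Suc_fn [Proj_fn 0]], Comp_fn Suc_fn [Proj_fn 1]]"
  have "evaluates ?f [k, z] (Suc z - triangle (Suc k))" for k z
    by (rule evaluates_Comp2[where y = "triangle (Suc k)" and y' = "Suc z"])
      (rule evaluates_minus evaluates_Comp1 evaluates_triangle evaluates.Suc evaluates_Proj | simp)+
  moreover have "\<exists>k. Suc z - triangle (Suc k) = 0" for z by (rule exI[of _ z]) simp
  ultimately have "computable_fun (\<lambda>z. LEAST k. Suc z - triangle (Suc k) = 0)"
    by (rule computable_fun_Least2)
  then show ?thesis by (simp add: diagonal_eq_Least)
qed

lemma computable_fun_nfst [computable]:
  assumes "computable_fun F"
  shows "computable_fun (\<lambda>x. nfst (F x))"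
proof -
  have "nfst z = z - triangle (nfst z + nsnd z)" for z
    using triangle_nfst_nsnd[of z] by linarith
  then have eq: "nfst = (\<lambda>z. z - triangle (nfst z + nsnd z))" by (rule ext)
  have "computable_fun nfst"
    by (subst eq) (intro computable_fun_minus computable_fun_ident computable_fun_triangle
        computable_fun_diagonal)
  then show ?thesis using assms by (rule computable_fun_comp)
qed

lemma computable_fun_nsnd [computable]:
  assumes "computable_fun F"
  shows "computable_fun (\<lambda>x. nsnd (F x))"
proof -
  have eq: "nsnd = (\<lambda>z. (nfst z + nsnd z) - nfst z)" by auto
  have "computable_fun nsnd"
    by (subst eq) (intro computable_fun_minus computable_fun_diagonal computable_fun_nfst
        computable_fun_ident)
  then show ?thesis using assms by (rule computable_fun_comp)
qed

text \<open>The step function may depend on the parameter x, so it is required to be computable on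
  coded triples. The program \<open>c\<close> packs the arguments [n, y, x] that
  \<open>Prec_fn\<close> supplies into such a triple.\<close>

lemma computable_fun_rec_nat [computable]:
  assumes A: "computable_fun A"
    and B: "computable_fun (\<lambda>z. B (nfst z) (nfst (nsnd z)) (nsnd (nsnd z)))"
    and N: "computable_fun N"
  shows "computable_fun (\<lambda>x. rec_nat (A x) (B x) (N x))"
proof -
  obtain a b where a: "\<And>x. evaluates a [x] (A x)"
    and b: "\<And>z. evaluates b [z] (B (nfst z) (nfst (nsnd z)) (nsnd (nsnd z)))"
    using A B unfolding computable_fun_def by blast
  define c where "c = Comp_fn b [Comp_fn pair_fn [Proj_fn 2, Comp_fn pair_fn [Proj_fn 0, Proj_fn 1]]]"
  have c: "evaluates c [n, y, x] (B x n y)" for n y x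
    unfolding c_def
  proof (rule evaluates_Comp1)
    show "evaluates (Comp_fn pair_fn [Proj_fn 2, Comp_fn pair_fn [Proj_fn 0, Proj_fn 1]]) [n, y, x]
      (prod_encode (x, prod_encode (n, y)))"
      by (rule evaluates_Comp2 evaluates_pair evaluates_Proj | simp)+
    show "evaluates b [prod_encode (x, prod_encode (n, y))] (B x n y)"
      using b[of "prod_encode (x, prod_encode (n, y))"] by simp
  qed
  have "evaluates (Prec_fn a c) [n, x] (rec_nat (A x) (B x) n)" for n x
    by (induction n) (auto intro: evaluates.Prec_0[OF a] evaluates.Prec_Suc[OF _ c])
  then have "computable_fun2 (\<lambda>n x. rec_nat (A x) (B x) n)"
    unfolding computable_fun2_def by blast
  then show ?thesis by (rule computable_fun2_comp) (intro N computable)+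
qed

subsection \<open>Decidable predicates\<close>

lemma decidable_comp: "decidable P \<Longrightarrow> computable_fun F \<Longrightarrow> decidable (\<lambda>x. P (F x))"
  unfolding decidable_def by (rule computable_fun_comp)

lemma decidable_comp2:
  assumes "decidable (\<lambda>z. P (nfst z) (nsnd z))" "computable_fun G" "computable_fun H"
  shows "decidable (\<lambda>x. P (G x) (H x))"
  using decidable_comp[OF assms(1) computable_fun_prod_encode[OF assms(2,3)]] by simp

lemma decidable_positive:
  assumes "computable_fun F"
  shows "decidable (\<lambda>x. F x > 0)"
proof -
  have "computable_fun (\<lambda>x. 1 - (1 - F x))" using assms by (intro computable)
  moreover have "(\<lambda>x. 1 - (1 - F x)) = (\<lambda>x. if F x > 0 then 1 else 0)" by auto
  ultimately show ?thesis by (simp add: decidable_def)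
qed

lemma decidable_not [computable]:
  assumes "decidable P"
  shows "decidable (\<lambda>x. \<not> P x)"
proof -
  have "computable_fun (\<lambda>x. 1 - (if P x then 1 else 0))"
    using assms unfolding decidable_def by (intro computable)
  moreover have "(\<lambda>x. 1 - (if P x then 1 else 0)) = (\<lambda>x. if \<not> P x then 1 else 0 :: nat)" by auto
  ultimately show ?thesis by (simp add: decidable_def)
qed

lemma decidable_conj [computable]:
  assumes "decidable P" "decidable Q"
  shows "decidable (\<lambda>x. P x \<and> Q x)"
proof -
  have "decidable (\<lambda>x. (if P x then 1 else 0) * (if Q x then 1 else 0 :: nat) > 0)"
    using assms unfolding decidable_def by (intro decidable_positive[unfolded decidable_def] computable)
  then show ?thesis by (rule back_subst[where P = decidable]) auto
qed

lemma decidable_disj [computable]: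
  assumes "decidable P" "decidable Q"
  shows "decidable (\<lambda>x. P x \<or> Q x)"
proof -
  have "decidable (\<lambda>x. \<not> (\<not> P x \<and> \<not> Q x))" using assms by (intro computable)
  then show ?thesis by simp
qed

lemma decidable_imp [computable]:
  assumes "decidable P" "decidable Q"
  shows "decidable (\<lambda>x. P x \<longrightarrow> Q x)"
proof -
  have "decidable (\<lambda>x. \<not> P x \<or> Q x)" using assms by (intro computable)
  then show ?thesis by (simp only: imp_conv_disj)
qed

lemma decidable_less [computable]:
  assumes "computable_fun F" "computable_fun G"
  shows "decidable (\<lambda>x. F x < G x)"
  using decidable_positive[OF computable_fun_minus[OF assms(2,1)]] by simp

lemma decidable_le [computable]:
  assumes "computable_fun F" "computable_fun G"
  shows "decidable (\<lambda>x. F x \<le> G x)"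
  using decidable_not[OF decidable_less[OF assms(2,1)]] by (simp add: not_less)

lemma decidable_eq [computable]:
  assumes "computable_fun F" "computable_fun G"
  shows "decidable (\<lambda>x. F x = G x)"
  using decidable_conj[OF decidable_le[OF assms] decidable_le[OF assms(2,1)]]
  by (simp add: order_eq_iff)

lemma decidable_all_less [computable]:
  assumes P: "decidable (\<lambda>z. P (nfst z) (nsnd z))" and B: "computable_fun B"
  shows "decidable (\<lambda>x. \<forall>i<B x. P x i)"
proof -
  \<comment> \<open>A bounded universal quantifier is a product of characteristic values, computed
    by primitive recursion.\<close>
  have eq: "rec_nat 1 (\<lambda>n y. y * (if P x n then 1 else 0)) b = (if \<forall>i<b. P x i then 1 else 0 :: nat)"
    for x b by (induction b) (auto simp: less_Suc_eq)
  have "computable_fun (\<lambda>z. if P (nfst z) (nfst (nsnd z)) then 1 else 0)"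
    using decidable_comp[OF P, of "\<lambda>z. prod_encode (nfst z, nfst (nsnd z))", unfolded decidable_def]
    by (simp add: computable)
  then have "computable_fun (\<lambda>x. rec_nat 1 (\<lambda>n y. y * (if P x n then 1 else 0)) (B x))"
    by (intro computable B)
  then show ?thesis by (simp only: eq decidable_def)
qed

lemma decidable_ex_less [computable]:
  assumes P: "decidable (\<lambda>z. P (nfst z) (nsnd z))" and B: "computable_fun B"
  shows "decidable (\<lambda>x. \<exists>i<B x. P x i)"
proof -
  have "decidable (\<lambda>x. \<not> (\<forall>i<B x. \<not> P x i))" using assms by (intro computable)
  then show ?thesis by simp
qed

lemma computable_fun_Least:
  assumes P: "decidable (\<lambda>z. P (nfst z) (nsnd z))" and ex: "\<And>x. \<exists>i. P x i"
  shows "computable_fun (\<lambda>x. LEAST i. P x i)"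
proof -
  \<comment> \<open>Negated because \<open>Mu_fn\<close> looks for a zero, and swapped because it
    puts the searched argument first.\<close>
  have "decidable (\<lambda>z. \<not> P (nsnd z) (nfst z))"
    using decidable_comp[OF P, of "\<lambda>z. prod_encode (nsnd z, nfst z)"] by (simp add: computable)
  then have "computable_fun (\<lambda>z. if \<not> P (nsnd z) (nfst z) then 1 else 0)" by (simp add: decidable_def)
  then have "computable_fun2 (\<lambda>i x. if \<not> P x i then 1 else 0)"
    by (intro computable_fun2_curry) (simp add: nfst_def nsnd_def)
  then obtain f where "\<And>x i. evaluates f [i, x] (if \<not> P x i then 1 else 0)"
    unfolding computable_fun2_def by blast
  then have "computable_fun (\<lambda>x. LEAST i. (if \<not> P x i then 1 else 0 :: nat) = 0)"
    by (rule computable_fun_Least2) (use ex in auto)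
  moreover have "(if \<not> P x i then 1 else 0 :: nat) = 0 \<longleftrightarrow> P x i" for x i by simp
  ultimately show ?thesis by (simp only:)
qed

subsection \<open>Codes of lists\<close>

definition chd :: "nat \<Rightarrow> nat" where "chd c = nfst (c - 1)"
definition ctl :: "nat \<Rightarrow> nat" where "ctl c = nsnd (c - 1)"
definition ccons :: "nat \<Rightarrow> nat \<Rightarrow> nat" where "ccons x c = Suc (prod_encode (x, c))"
definition cdrop :: "nat \<Rightarrow> nat \<Rightarrow> nat" where "cdrop i c = rec_nat c (\<lambda>_. ctl) i"
definition cnth :: "nat \<Rightarrow> nat \<Rightarrow> nat" where "cnth c i = chd (cdrop i c)"
definition clength :: "nat \<Rightarrow> nat" where "clength c = (LEAST i. cdrop i c = 0)"

lemma ccons_list_encode [simp]: "ccons x (list_encode xs) = list_encode (x # xs)"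
  by (simp add: ccons_def)

lemma chd_list_encode [simp]: "chd (list_encode (x # xs)) = x"
  by (simp add: chd_def)

lemma ctl_list_encode [simp]: "ctl (list_encode xs) = list_encode (tl xs)"
  by (cases xs) (simp_all add: ctl_def)

text \<open>Codes stay in the form \<open>list_encode (x # xs)\<close>, on which the rules for
  \<open>chd\<close>, \<open>ctl\<close> and \<open>cnth\<close> fire.\<close>

declare list_encode.simps [simp del]

lemma list_encode_Nil [simp]: "list_encode [] = 0"
  by (simp add: list_encode.simps)

lemma list_encode_eq_0 [simp]: "list_encode xs = 0 \<longleftrightarrow> xs = []"
  by (cases xs) (simp_all add: list_encode.simps)

lemma cdrop_list_encode [simp]: "cdrop i (list_encode xs) = list_encode (drop i xs)"
proof (induction i)
  case (Suc i)
  then show ?case by (simp add: cdrop_def tl_drop[symmetric] drop_Suc)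
qed (simp add: cdrop_def)

lemma cnth_list_encode [simp]: "i < length xs \<Longrightarrow> cnth (list_encode xs) i = xs ! i"
  by (simp add: cnth_def Cons_nth_drop_Suc[symmetric])

lemma clength_list_encode [simp]: "clength (list_encode xs) = length xs"
  unfolding clength_def by (rule Least_equality) auto

lemma list_code_cases: obtains xs where "c = list_encode xs"
  by (metis list_decode_inverse)

lemma computable_fun_chd [computable]: "computable_fun F \<Longrightarrow> computable_fun (\<lambda>x. chd (F x))"
  unfolding chd_def by (intro computable)

lemma computable_fun_ctl [computable]: "computable_fun F \<Longrightarrow> computable_fun (\<lambda>x. ctl (F x))"
  unfolding ctl_def by (intro computable)

lemma computable_fun_ccons [computable]:
  "computable_fun F \<Longrightarrow> computable_fun G \<Longrightarrow> computable_fun (\<lambda>x. ccons (F x) (G x))"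
  unfolding ccons_def by (intro computable)

lemma computable_fun_cdrop [computable]:
  "computable_fun F \<Longrightarrow> computable_fun G \<Longrightarrow> computable_fun (\<lambda>x. cdrop (F x) (G x))"
  unfolding cdrop_def by (intro computable)

lemma computable_fun_cnth [computable]:
  "computable_fun F \<Longrightarrow> computable_fun G \<Longrightarrow> computable_fun (\<lambda>x. cnth (F x) (G x))"
  unfolding cnth_def by (intro computable)

lemma computable_fun_clength [computable]:
  assumes "computable_fun F"
  shows "computable_fun (\<lambda>x. clength (F x))"
proof -
  have "\<exists>i. cdrop i c = 0" for c
    by (cases c rule: list_code_cases) auto
  then have "computable_fun clength"
    unfolding clength_def by (intro computable_fun_Least computable)
  then show ?thesis using assms by (rule computable_fun_comp)
qed

lemma bex_set_list_decode_iff: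
  "(\<exists>v\<in>set (list_decode c). P v) \<longleftrightarrow> (\<exists>i<clength c. P (cnth c i))"
  by (cases c rule: list_code_cases) (auto simp: set_conv_nth)

lemma decidable_bex_list [computable]:
  assumes P: "decidable (\<lambda>z. P (nfst z) (nsnd z))" and F: "computable_fun F"
  shows "decidable (\<lambda>x. \<exists>v\<in>set (list_decode (F x)). P x v)"
  unfolding bex_set_list_decode_iff
proof (intro decidable_ex_less computable_fun_clength F)
  have "decidable (\<lambda>z. P (nfst (prod_encode (nfst z, cnth (F (nfst z)) (nsnd z))))
      (nsnd (prod_encode (nfst z, cnth (F (nfst z)) (nsnd z)))))"
    by (intro decidable_comp[OF P] computable computable_fun_comp[OF F])
  then show "decidable (\<lambda>z. P (nfst z) (cnth (F (nfst z)) (nsnd z)))" by simp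
qed

lemma decidable_in_list [computable]:
  assumes "computable_fun F" "computable_fun G"
  shows "decidable (\<lambda>x. F x \<in> set (list_decode (G x)))"
proof -
  have "decidable (\<lambda>x. \<exists>v\<in>set (list_decode (G x)). v = F x)"
    using assms by (intro computable computable_fun_comp[OF assms(1)])
  then show ?thesis by simp
qed

section \<open>Certificates for computations\<close>

text \<open>The first component is a tag for the constructor. Numbers that code no program are not
  filtered out anywhere: they may have certificates too, but soundness and completeness speak of
  codes only.\<close>

fun recf_code :: "recf \<Rightarrow> nat" where
  "recf_code Zero_fn = prod_encode (0, 0)"
| "recf_code Suc_fn = prod_encode (1, 0)"
| "recf_code (Proj_fn i) = prod_encode (2, i)"
| "recf_code (Comp_fn f gs) =
    prod_encode (3, prod_encode (recf_code f, list_encode (map recf_code gs)))"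
| "recf_code (Prec_fn f g) = prod_encode (4, prod_encode (recf_code f, recf_code g))"
| "recf_code (Mu_fn f) = prod_encode (5, recf_code f)"

definition eval_code :: "nat \<Rightarrow> nat \<Rightarrow> nat \<Rightarrow> nat" where
  "eval_code e x y = prod_encode (e, prod_encode (x, y))"

text \<open>
  The statement that \<open>e\<close> evaluates to \<open>y\<close> at \<open>x\<close> follows from the statements in \<open>S\<close> by one of the
  rules of \<open>evaluates\<close>.
\<close>

definition justified :: "nat set \<Rightarrow> nat \<Rightarrow> nat \<Rightarrow> nat \<Rightarrow> bool" where
  "justified S e x y \<longleftrightarrow>
    e = prod_encode (0, 0) \<and> y = 0 \<or>
    e = prod_encode (1, 0) \<and> clength x = 1 \<and> y = Suc (chd x) \<or>
    nfst e = 2 \<and> nsnd e < clength x \<and> y = cnth x (nsnd e) \<or>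
    nfst e = 3 \<and> (\<exists>l\<in>S. nfst l = nfst (nsnd e) \<and> nsnd (nsnd l) = y \<and>
      clength (nfst (nsnd l)) = clength (nsnd (nsnd e)) \<and>
      (\<forall>i<clength (nsnd (nsnd e)).
        eval_code (cnth (nsnd (nsnd e)) i) x (cnth (nfst (nsnd l)) i) \<in> S)) \<or>
    nfst e = 4 \<and> x \<noteq> 0 \<and> chd x = 0 \<and> eval_code (nfst (nsnd e)) (ctl x) y \<in> S \<or>
    nfst e = 4 \<and> x \<noteq> 0 \<and> chd x \<noteq> 0 \<and>
      (\<exists>l\<in>S. nfst l = e \<and> nfst (nsnd l) = ccons (chd x - 1) (ctl x) \<and>
        eval_code (nsnd (nsnd e)) (ccons (chd x - 1) (ccons (nsnd (nsnd l)) (ctl x))) y \<in> S) \<or>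
    nfst e = 5 \<and> eval_code (nsnd e) (ccons y x) 0 \<in> S \<and>
      (\<forall>m<y. \<exists>l\<in>S. nfst l = nsnd e \<and> nfst (nsnd l) = ccons m x \<and> 0 < nsnd (nsnd l))"

text \<open>The order of the list excludes circular reasoning: an entry may appeal only to entries
  behind it.\<close>

fun valid_certificate :: "nat list \<Rightarrow> bool" where
  "valid_certificate [] \<longleftrightarrow> True"
| "valid_certificate (l # L) \<longleftrightarrow>
    justified (set L) (nfst l) (nfst (nsnd l)) (nsnd (nsnd l)) \<and> valid_certificate L"

lemma nfst_eval_code [simp]: "nfst (eval_code e x y) = e"
  and nfst_nsnd_eval_code [simp]: "nfst (nsnd (eval_code e x y)) = x"
  and nsnd_nsnd_eval_code [simp]: "nsnd (nsnd (eval_code e x y)) = y"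
  by (simp_all add: eval_code_def)

lemma eval_code_surj: "eval_code (nfst l) (nfst (nsnd l)) (nsnd (nsnd l)) = l"
  by (simp add: eval_code_def)

text \<open>\<open>S\<close> occurs only positively in \<open>justified\<close>. This is what allows
  certificates to be concatenated.\<close>

lemma justified_mono: "justified S e x y \<Longrightarrow> S \<subseteq> S' \<Longrightarrow> justified S' e x y"
  unfolding justified_def by (elim disj_forward conj_forward all_forward imp_forward) (assumption | blast)+

text \<open>Every quantifier in \<open>justified\<close> ranges over a listed finite set or below a
  given number. The recursion along the list becomes a bounded quantifier over positions, the
  entries behind position i being coded by \<open>cdrop (Suc i) c\<close>.\<close>

lemma decidable_valid_certificate [computable]:
  assumes "computable_fun F"
  shows "decidable (\<lambda>x. valid_certificate (list_decode (F x)))"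
proof -
  define Q where "Q c l = justified (set (list_decode c)) (nfst l) (nfst (nsnd l)) (nsnd (nsnd l))" for c l
  have Q: "decidable (\<lambda>z. Q (nfst z) (nsnd z))"
    unfolding Q_def justified_def eval_code_def by (intro computable)
  have "valid_certificate (list_decode c) \<longleftrightarrow> (\<forall>i<clength c. Q (cdrop (Suc i) c) (cnth c i))" for c
  proof (cases c rule: list_code_cases)
    case (1 L)
    have "valid_certificate L \<longleftrightarrow> (\<forall>i<length L. Q (list_encode (drop (Suc i) L)) (L ! i))"
    proof (induction L)
      case (Cons l L)
      show ?case
        by (simp only: valid_certificate.simps Cons list.size) (simp add: Q_def All_less_Suc2)
    qed simp
    with 1 show ?thesis by simp
  qed
  moreover have "decidable (\<lambda>c. \<forall>i<clength c. Q (cdrop (Suc i) c) (cnth c i))"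
    by (intro decidable_all_less decidable_comp2[OF Q] computable)
  ultimately have "decidable (\<lambda>c. valid_certificate (list_decode c))" by simp
  then show ?thesis using assms by (rule decidable_comp)
qed

text \<open>The tag of \<open>recf_code f\<close> leaves only the disjuncts that belong to the
  constructor of \<open>f\<close>, and these are the rules of \<open>evaluates\<close> read
  backwards.\<close>

lemma evaluates_if_justified:
  assumes S: "\<And>f xs y. eval_code (recf_code f) (list_encode xs) y \<in> S \<Longrightarrow> evaluates f xs y"
    and j: "justified S (recf_code f) (list_encode xs) y"
  shows "evaluates f xs y"
proof (cases f)
  case Zero_fn
  then show ?thesis using j by (auto simp: justified_def intro: evaluates.Zero)
next
  case Suc_fn
  then show ?thesis using j
    by (auto simp: justified_def length_Suc_conv intro: evaluates.Suc)
next
  case (Proj_fn i)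
  then show ?thesis using j by (auto simp: justified_def intro: evaluates_Proj)
next
  case (Comp_fn g hs)
  then obtain l where l: "l \<in> S" "nfst l = recf_code g" "nsnd (nsnd l) = y"
      "clength (nfst (nsnd l)) = length hs"
      "\<forall>i<length hs. eval_code (recf_code (hs ! i)) (list_encode xs) (cnth (nfst (nsnd l)) i) \<in> S"
    using j by (auto simp: justified_def)
  obtain ys where ys: "nfst (nsnd l) = list_encode ys" by (rule list_code_cases)
  have "eval_code (recf_code g) (list_encode ys) y \<in> S"
    using l(1-3) ys eval_code_surj[of l] by simp
  moreover have "list_all2 (\<lambda>h z. evaluates h xs z) hs ys"
    using l(4,5) S by (auto simp: ys list_all2_conv_all_nth)
  ultimately show ?thesis unfolding Comp_fn using S evaluates.Comp by blast
next
  case (Prec_fn g h)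
  then have x: "xs \<noteq> []" using j by (auto simp: justified_def)
  then obtain n zs where xs: "xs = n # zs" by (cases xs) auto
  show ?thesis
  proof (cases n)
    case 0
    then have "eval_code (recf_code g) (list_encode zs) y \<in> S"
      using j by (simp add: xs Prec_fn justified_def)
    then show ?thesis using S by (simp add: xs Prec_fn 0 evaluates.Prec_0)
  next
    case (Suc k)
    then obtain l where l: "l \<in> S" "nfst l = recf_code f" "nfst (nsnd l) = list_encode (k # zs)"
        "eval_code (recf_code h) (list_encode (k # nsnd (nsnd l) # zs)) y \<in> S"
      using j by (auto simp: xs Prec_fn justified_def)
    have "evaluates f (k # zs) (nsnd (nsnd l))"
      using S[of f "k # zs" "nsnd (nsnd l)"] l(1-3) eval_code_surj[of l] by simp
    then show ?thesis using S[OF l(4)] by (auto simp: xs Prec_fn Suc intro: evaluates.Prec_Suc)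
  qed
next
  case (Mu_fn g)
  have j: "eval_code (recf_code g) (list_encode (y # xs)) 0 \<in> S"
      "\<forall>m<y. \<exists>l\<in>S. nfst l = recf_code g \<and> nfst (nsnd l) = list_encode (m # xs) \<and> 0 < nsnd (nsnd l)"
    using j by (simp_all add: Mu_fn justified_def)
  have "evaluates g (y # xs) 0" using j(1) by (rule S)
  moreover have "\<exists>z>0. evaluates g (m # xs) z" if "m < y" for m
  proof -
    obtain l where l: "l \<in> S" "nfst l = recf_code g" "nfst (nsnd l) = list_encode (m # xs)"
        "0 < nsnd (nsnd l)"
      using j(2) \<open>m < y\<close> by blast
    then have "evaluates g (m # xs) (nsnd (nsnd l))"
      using S[of g "m # xs" "nsnd (nsnd l)"] eval_code_surj[of l] by simp
    with l(4) show ?thesis by blast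
  qed
  ultimately show ?thesis unfolding Mu_fn by (blast intro: evaluates.Mu)
qed

lemma valid_certificate_sound:
  "valid_certificate L \<Longrightarrow> eval_code (recf_code f) (list_encode xs) y \<in> set L \<Longrightarrow> evaluates f xs y"
proof (induction L arbitrary: f xs y)
  case (Cons l L)
  show ?case
  proof (cases "eval_code (recf_code f) (list_encode xs) y \<in> set L")
    case False
    then have "l = eval_code (recf_code f) (list_encode xs) y" using Cons.prems(2) by auto
    then have "justified (set L) (recf_code f) (list_encode xs) y" using Cons.prems(1) by simp
    then show ?thesis using Cons.prems(1) by (intro evaluates_if_justified[OF Cons.IH]) simp_all
  qed (use Cons in auto)
qed simp

lemma valid_certificate_append:
  "valid_certificate K \<Longrightarrow> valid_certificate L \<Longrightarrow> valid_certificate (K @ L)"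
  by (induction K) (auto intro: justified_mono)

definition certified :: "nat \<Rightarrow> bool" where
  "certified l \<longleftrightarrow> (\<exists>L. valid_certificate L \<and> l \<in> set L)"

lemma certified_finite:
  assumes "finite S" "\<And>l. l \<in> S \<Longrightarrow> certified l"
  shows "\<exists>L. valid_certificate L \<and> S \<subseteq> set L"
  using assms
proof (induction S)
  case empty
  show ?case by (rule exI[of _ "[]"]) simp
next
  case (insert l S)
  then obtain K L where "valid_certificate K" "l \<in> set K" "valid_certificate L" "S \<subseteq> set L"
    unfolding certified_def by blast
  then show ?case by (intro exI[of _ "K @ L"]) (auto simp: valid_certificate_append)
qed

text \<open>One rule of \<open>evaluates\<close> at a time: concatenate the certificates of its
  finitely many premises and put the conclusion in front.\<close>

lemma certified_if_justified:
  assumes "finite S" "\<And>l. l \<in> S \<Longrightarrow> certified l" "justified S e x y"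
  shows "certified (eval_code e x y)"
proof -
  obtain L where "valid_certificate L" "S \<subseteq> set L" using certified_finite assms by blast
  then have "valid_certificate (eval_code e x y # L)" using assms(3) by (auto intro: justified_mono)
  then show ?thesis unfolding certified_def by (intro exI[of _ "eval_code e x y # L"]) simp
qed

lemma certified_if_evaluates:
  "evaluates f xs y \<Longrightarrow> certified (eval_code (recf_code f) (list_encode xs) y)"
proof (induction rule: evaluates.induct)
  case (Zero xs)
  show ?case by (rule certified_if_justified[of "{}"]) (auto simp: justified_def)
next
  case (Suc x)
  show ?case by (rule certified_if_justified[of "{}"]) (auto simp: justified_def)
next
  case (Proj i xs)
  then show ?case by (intro certified_if_justified[of "{}"]) (auto simp: justified_def)
next
  case (Comp xs gs ys f z)
  let ?S = "insert (eval_code (recf_code f) (list_encode ys) z)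
    ((\<lambda>i. eval_code (recf_code (gs ! i)) (list_encode xs) (ys ! i)) ` {..<length gs})"
  show ?case
  proof (rule certified_if_justified[of ?S])
    show "certified l" if "l \<in> ?S" for l
      using that Comp by (auto simp: list_all2_conv_all_nth)
    have "length gs = length ys" using Comp by (auto simp: list_all2_conv_all_nth)
    then show "justified ?S (recf_code (Comp_fn f gs)) (list_encode xs) z"
      unfolding justified_def by (auto intro!: bexI[of _ "eval_code (recf_code f) (list_encode ys) z"])
  qed simp
next
  case (Prec_0 f xs y g)
  show ?case
    by (rule certified_if_justified[of "{eval_code (recf_code f) (list_encode xs) y}"])
      (use Prec_0 in \<open>auto simp: justified_def\<close>)
next
  case (Prec_Suc f g n xs y z)
  show ?case
    by (rule certified_if_justified[of "{eval_code (recf_code (Prec_fn f g)) (list_encode (n # xs)) y,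
        eval_code (recf_code g) (list_encode (n # y # xs)) z}"])
      (use Prec_Suc in \<open>auto simp: justified_def\<close>)
next
  case (Mu f n xs)
  \<comment> \<open>The values \<open>h m\<close> witness that the search does not stop before
    n.\<close>
  then obtain h where h: "\<And>m. m < n \<Longrightarrow> 0 < h m"
      "\<And>m. m < n \<Longrightarrow> certified (eval_code (recf_code f) (list_encode (m # xs)) (h m))"
    by metis
  let ?S = "insert (eval_code (recf_code f) (list_encode (n # xs)) 0)
    ((\<lambda>m. eval_code (recf_code f) (list_encode (m # xs)) (h m)) ` {..<n})"
  show ?case
  proof (rule certified_if_justified[of ?S])
    show "certified l" if "l \<in> ?S" for l
      using that Mu h by auto
    show "justified ?S (recf_code (Mu_fn f)) (list_encode xs) n"
      unfolding justified_def using h(1) by auto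
  qed simp
qed

definition certifies :: "nat list \<Rightarrow> nat \<Rightarrow> nat list \<Rightarrow> nat \<Rightarrow> bool" where
  "certifies L e xs y \<longleftrightarrow> valid_certificate L \<and> eval_code e (list_encode xs) y \<in> set L"

lemma evaluates_iff_certifies: "evaluates f xs y \<longleftrightarrow> (\<exists>L. certifies L (recf_code f) xs y)"
  unfolding certifies_def using valid_certificate_sound certified_if_evaluates certified_def by metis

section \<open>Order types\<close>

lemma has_order_type_iff_ordIso: "has_order_type r \<alpha> \<longleftrightarrow> r =o rep_ordinal \<alpha>"
  by (simp add: has_order_type_def)

lemma less_iff_ordLess:
  assumes "has_order_type r \<alpha>" "has_order_type s \<beta>"
  shows "\<alpha> < \<beta> \<longleftrightarrow> r <o s"
  using assms unfolding has_order_type_iff_ordIso less_ordinal_def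
  by (auto intro: ordIso_ordLess_trans ordLess_ordIso_trans ordIso_symmetric)

lemma has_order_type_unique:
  assumes "has_order_type r \<alpha>" "has_order_type s \<beta>" "r =o s"
  shows "\<alpha> = \<beta>"
  using assms less_iff_ordLess[of r \<alpha> s \<beta>] less_iff_ordLess[of s \<beta> r \<alpha>]
  by (meson not_ordLess_ordIso ordIso_symmetric linorder_neqE)

lemma ex_has_order_type:
  fixes r :: "nat rel"
  assumes "Well_order r"
  shows "\<exists>\<alpha>. has_order_type r \<alpha>"
proof -
  \<comment> \<open>Singletons carry the order over to \<open>nat set\<close>, the type on which
    ordinals are represented.\<close>
  have "r =o dir_image r (\<lambda>n. {n})"
    using assms by (intro dir_image_ordIso) (auto simp: inj_on_def)
  moreover from this have "Well_order (dir_image r (\<lambda>n. {n}))" by (simp add: ordIso_def)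
  ultimately have "has_order_type r (abs_ordinal (dir_image r (\<lambda>n. {n})))"
    by (simp add: has_order_type.abs_eq ordIso_reflexive)
  then show ?thesis ..
qed

text \<open>\<open>h x\<close> is the order type of the strict initial segment below x; on the field
  of r it is the canonical isomorphism onto the ordinals below \<alpha>.\<close>

lemma order_type_rank:
  fixes r :: "nat rel"
  assumes r: "Well_order r" and \<alpha>: "has_order_type r \<alpha>"
  obtains h where "\<And>x. x \<in> Field r \<Longrightarrow> h x < \<alpha>"
    and "\<And>x y. (x, y) \<in> r \<Longrightarrow> x \<noteq> y \<Longrightarrow> h x < h y"
    and "\<And>\<beta>. \<beta> < \<alpha> \<Longrightarrow> \<exists>x\<in>Field r. h x = \<beta>"
    and "\<And>x. has_order_type (Restr r (underS r x)) (h x)"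
proof -
  have R: "Well_order (Restr r (underS r x))" for x using r by (rule Well_order_Restr)
  then have "\<exists>h. \<forall>x. has_order_type (Restr r (underS r x)) (h x)"
    by (intro choice allI ex_has_order_type)
  then obtain h where h: "has_order_type (Restr r (underS r x)) (h x)" for x by blast
  show thesis
  proof (rule that[OF _ _ _ h])
    fix x assume "x \<in> Field r"
    then have "Restr r (underS r x) <o r" using r by (intro underS_Restr_ordLess) auto
    then show "h x < \<alpha>" using less_iff_ordLess[OF h \<alpha>] by blast
  next
    fix x y assume xy: "(x, y) \<in> r" "x \<noteq> y"
    have w: "wo_rel r" using r by (simp add: wo_rel_def)
    have "(y, x) \<notin> r" using xy r
      by (auto simp: well_order_on_def linear_order_on_def partial_order_on_def antisym_def)
    then have "x \<in> underS r y" "x \<notin> underS r x" "underS r x \<subseteq> underS r y" using xy r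
      by (auto simp: underS_def well_order_on_def linear_order_on_def partial_order_on_def
          preorder_on_def elim: transE)
    then have "underS r x \<subset> underS r y" by blast
    then have "Restr r (underS r x) <o Restr r (underS r y)"
      using ofilter_subset_ordLess[OF r wo_rel.underS_ofilter[OF w] wo_rel.underS_ofilter[OF w]]
      by blast
    then show "h x < h y" using less_iff_ordLess[OF h h] by blast
  next
    fix \<beta> assume "\<beta> < \<alpha>"
    then have "rep_ordinal \<beta> <o r"
      using \<alpha> unfolding has_order_type_iff_ordIso less_ordinal_def
      by (auto intro: ordLess_ordIso_trans ordIso_symmetric)
    then obtain x where x: "x \<in> Field r" "rep_ordinal \<beta> =o Restr r (underS r x)"
      using ordLess_iff_ordIso_Restr[OF r Well_order_rep] by blast
    have "h x = \<beta>"
      by (rule has_order_type_unique[OF h[of x] _ ordIso_symmetric[OF x(2)]])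
        (simp add: has_order_type_iff_ordIso ordIso_reflexive Well_order_rep)
    with x(1) show "\<exists>x\<in>Field r. h x = \<beta>" by blast
  qed
qed

lemma decidable_image_prod_encode:
  "computable_set (prod_encode ` r) \<longleftrightarrow> decidable (\<lambda>z. (nfst z, nsnd z) \<in> r)"
proof -
  have "z \<in> prod_encode ` r \<longleftrightarrow> (nfst z, nsnd z) \<in> r" for z
    by (metis image_iff nfst_prod_encode nsnd_prod_encode prod.exhaust prod_encode_nfst_nsnd)
  then show ?thesis by (simp add: computable_set_iff_decidable)
qed

text \<open>\<beta> is the type of the initial segment below some point x, and that segment is
  decidable with x as a fixed constant.\<close>

lemma computable_ordinal_less:
  assumes "computable_ordinal \<alpha>" "\<beta> < \<alpha>"
  shows "computable_ordinal \<beta>"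
proof -
  obtain r :: "nat rel" where r: "Well_order r" "computable_set (prod_encode ` r)"
      "has_order_type r \<alpha>"
    using assms(1) computable_ordinal_def by blast
  obtain h where h: "\<And>\<beta>. \<beta> < \<alpha> \<Longrightarrow> \<exists>x\<in>Field r. h x = \<beta>"
      "\<And>x. has_order_type (Restr r (underS r x)) (h x)"
    using order_type_rank[OF r(1,3)] by metis
  obtain x where x: "h x = \<beta>" using h(1)[OF assms(2)] by blast
  have dr: "decidable (\<lambda>z. (nfst z, nsnd z) \<in> r)"
    using r(2) by (simp add: decidable_image_prod_encode)
  have "decidable (\<lambda>z. (nfst z, nsnd z) \<in> r \<and> (nfst z \<noteq> x \<and> (nfst z, x) \<in> r) \<and>
      nsnd z \<noteq> x \<and> (nsnd z, x) \<in> r)"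
    by (intro computable decidable_comp2[of "\<lambda>a b. (a, b) \<in> r", OF dr])
  then have "computable_set (prod_encode ` Restr r (underS r x))"
    by (simp add: decidable_image_prod_encode underS_def)
  moreover have "Well_order (Restr r (underS r x))" using r(1) by (rule Well_order_Restr)
  ultimately show ?thesis using h(2)[of x] x unfolding computable_ordinal_def by blast
qed

lemma less_omega1_CK_iff: "\<alpha> < omega1_CK \<longleftrightarrow> computable_ordinal \<alpha>"
proof
  show "\<alpha> < omega1_CK \<Longrightarrow> computable_ordinal \<alpha>"
    unfolding omega1_CK_def using not_less_Least by blast
  have "\<not> computable_ordinal omega1_CK"
    unfolding omega1_CK_def using ex_not_computable_ordinal by (rule LeastI_ex)
  then show "computable_ordinal \<alpha> \<Longrightarrow> \<alpha> < omega1_CK"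
    using computable_ordinal_less by (metis linorder_neqE)
qed

section \<open>The Kleene--Brouwer order\<close>

text \<open>The Kleene-Brouwer order in the direction that puts proper extensions before their
  prefixes, so that climbing the tree means descending in the order.\<close>

fun kb :: "nat list \<Rightarrow> nat list \<Rightarrow> bool" where
  "kb [] ys \<longleftrightarrow> False"
| "kb (x # xs) [] \<longleftrightarrow> True"
| "kb (x # xs) (y # ys) \<longleftrightarrow> x < y \<or> x = y \<and> kb xs ys"

lemma kb_irrefl: "\<not> kb xs xs"
  by (induction xs) auto

lemma kb_trans: "kb xs ys \<Longrightarrow> kb ys zs \<Longrightarrow> kb xs zs"
proof (induction xs ys arbitrary: zs rule: kb.induct)
  case (3 x xs y ys)
  then show ?case by (cases zs) auto
qed auto

lemma kb_total: "xs = ys \<or> kb xs ys \<or> kb ys xs"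
proof (induction xs ys rule: kb.induct)
  case (1 ys)
  then show ?case by (cases ys) auto
qed auto

lemma kb_append [simp]: "kb (us @ xs) (us @ ys) \<longleftrightarrow> kb xs ys"
  by (induction us) auto

lemma not_kb_self_append [simp]: "\<not> kb us (us @ ys)"
  using kb_append[of us "[]" ys] by simp

lemma kb_append_self: "xs \<noteq> [] \<Longrightarrow> kb (us @ xs) us"
  using kb_append[of us xs "[]"] by (cases xs) simp_all

text \<open>The comparison at the first difference has bounded quantifiers only, which makes
  \<open>kb\<close> decidable on codes.\<close>

lemma kb_iff_nth:
  "kb xs ys \<longleftrightarrow> (\<exists>i<length xs. i \<le> length ys \<and> (\<forall>j<i. xs ! j = ys ! j) \<and>
    (i = length ys \<or> xs ! i < ys ! i))"
proof (induction xs ys rule: kb.induct)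
  case (3 x xs y ys)
  then show ?case by (auto simp: Ex_less_Suc2 All_less_Suc2)
qed auto

text \<open>Children are smaller than parents, so membership in
  \<open>Wellfounded.acc (child_rel T)\<close> means that the subtree above the node has no infinite
  path.\<close>

definition child_rel :: "nat list set \<Rightarrow> nat list rel" where
  "child_rel T = {(s @ [x], s) |s x. s @ [x] \<in> T}"

text \<open>Unless A is \<open>{t}\<close>, move to the leftmost child of t with an element of A at
  or above it. What is minimal there is minimal in A, since t itself and everything above children
  further to the right come later.\<close>

lemma kb_minimal:
  assumes "is_tree T" "t \<in> Wellfounded.acc (child_rel T)"
    and "A \<subseteq> {s \<in> T. prefix t s}" "A \<noteq> {}"
  shows "\<exists>m\<in>A. \<forall>s\<in>A. \<not> kb s m"
  using assms(2-)
proof (induction t arbitrary: A rule: acc.induct)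
  case (accI t)
  show ?case
  proof (cases "A \<subseteq> {t}")
    case True
    then have "A = {t}" using accI.prems by blast
    then show ?thesis by (simp add: kb_irrefl)
  next
    case False
    then obtain s where s: "s \<in> A" "s \<noteq> t" "prefix t s" using accI.prems by blast
    then obtain x0 zs where "s = t @ x0 # zs" by (metis append_Nil2 neq_Nil_conv prefix_def)
    then have ex: "\<exists>s\<in>A. prefix (t @ [x0]) s" using s(1) by (auto simp: prefix_def)
    define x where "x = (LEAST x. \<exists>s\<in>A. prefix (t @ [x]) s)"
    have x: "\<exists>s\<in>A. prefix (t @ [x]) s"
      unfolding x_def by (rule LeastI[of _ x0]) (rule ex)
    then have "t @ [x] \<in> T" using accI.prems(1) assms(1) unfolding is_tree_def by blast
    then have "(t @ [x], t) \<in> child_rel T" by (auto simp: child_rel_def)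
    moreover have "{s \<in> A. prefix (t @ [x]) s} \<subseteq> {s \<in> T. prefix (t @ [x]) s}"
      using accI.prems(1) by blast
    moreover have "{s \<in> A. prefix (t @ [x]) s} \<noteq> {}" using x by blast
    ultimately have "\<exists>m\<in>{s \<in> A. prefix (t @ [x]) s}. \<forall>s\<in>{s \<in> A. prefix (t @ [x]) s}. \<not> kb s m"
      by (rule accI.IH)
    then obtain m where m: "m \<in> A" "prefix (t @ [x]) m"
        "\<forall>s\<in>A. prefix (t @ [x]) s \<longrightarrow> \<not> kb s m"
      by blast
    have "\<not> kb s m" if "s \<in> A" for s
    proof
      assume kb: "kb s m"
      have "prefix t s" using that accI.prems(1) by blast
      then obtain zs where zs: "s = t @ zs" by (auto simp: prefix_def)
      obtain ms where ms: "m = t @ x # ms" using m(2) by (auto simp: prefix_def)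
      obtain y ys where y: "zs = y # ys" "y \<le> x"
        using kb unfolding zs ms by (cases zs) auto
      have py: "prefix (t @ [y]) s" by (simp add: zs y prefix_def)
      then have "x \<le> y" unfolding x_def using that by (intro Least_le) blast
      then show False using m(3) that kb py y(2) by auto
    qed
    then show ?thesis using m(1) by blast
  qed
qed

definition kb_order :: "nat list set \<Rightarrow> nat list \<Rightarrow> nat list rel" where
  "kb_order T t = {(u, v). u \<in> T \<and> v \<in> T \<and> prefix t u \<and> prefix t v \<and> (u = v \<or> kb u v)}"

lemma Field_kb_order: "Field (kb_order T t) = {s \<in> T. prefix t s}"
  by (auto simp: kb_order_def Field_def)

lemma Well_order_kb_order:
  assumes "is_tree T" "t \<in> Wellfounded.acc (child_rel T)"
  shows "Well_order (kb_order T t)"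
  unfolding well_order_on_def linear_order_on_def partial_order_on_def preorder_on_def
proof (intro conjI)
  show "kb_order T t \<subseteq> Field (kb_order T t) \<times> Field (kb_order T t)" by (auto simp: Field_def)
  show "Refl (kb_order T t)" by (auto simp: refl_on_def Field_kb_order) (auto simp: kb_order_def)
  show "trans (kb_order T t)" by (auto simp: trans_def kb_order_def intro: kb_trans)
  show "antisym (kb_order T t)"
    by (auto simp: antisym_def kb_order_def) (metis kb_irrefl kb_trans)+
  show "Total (kb_order T t)"
    unfolding total_on_def Field_kb_order using kb_total by (auto simp: kb_order_def)
  show "wf (kb_order T t - Id)"
  proof (rule wfI_min)
    fix s Q assume s: "s \<in> (Q :: nat list set)"
    show "\<exists>m\<in>Q. \<forall>u. (u, m) \<in> kb_order T t - Id \<longrightarrow> u \<notin> Q"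
    proof (cases "Q \<inter> {s \<in> T. prefix t s} = {}")
      case True
      then show ?thesis using s by (auto simp: kb_order_def)
    next
      case False
      then obtain m where "m \<in> Q \<inter> {s \<in> T. prefix t s}"
          "\<forall>s\<in>Q \<inter> {s \<in> T. prefix t s}. \<not> kb s m"
        using kb_minimal[OF assms, of "Q \<inter> {s \<in> T. prefix t s}"] by auto
      then show ?thesis by (intro bexI[of _ m]) (auto simp: kb_order_def)
    qed
  qed
qed

lemma computable_kb_order:
  assumes "computable_set (list_encode ` T)"
  shows "computable_set (prod_encode ` dir_image (kb_order T t) list_encode)"
proof -
  \<comment> \<open>\<open>E\<close> and \<open>K\<close> express on codes the field of the order
    and, through \<open>kb_iff_nth\<close>, the relation \<open>kb\<close>;
    \<open>list_encode t\<close> is a constant.\<close>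
  define E where "E x \<longleftrightarrow> x \<in> list_encode ` T \<and> length t \<le> clength x \<and>
    (\<forall>j<length t. cnth x j = cnth (list_encode t) j)" for x
  define K where "K x y \<longleftrightarrow> (\<exists>i<clength x. i \<le> clength y \<and> (\<forall>j<i. cnth x j = cnth y j) \<and>
    (i = clength y \<or> cnth x i < cnth y i))" for x y
  have T: "decidable (\<lambda>x. x \<in> list_encode ` T)" using assms by (simp add: computable_set_iff_decidable)
  have E: "decidable E" unfolding E_def by (intro computable T)
  have K: "decidable (\<lambda>z. K (nfst z) (nsnd z))" unfolding K_def by (intro computable)
  have E_iff: "E (list_encode u) \<longleftrightarrow> u \<in> T \<and> prefix t u" for u
  proof -
    have "prefix t u \<longleftrightarrow> length t \<le> length u \<and> (\<forall>j<length t. u ! j = t ! j)"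
      unfolding prefix_def
      by (metis append_take_drop_id length_append le_add1 length_take min.absorb2 nth_append nth_equalityI nth_take)
    moreover have "E (list_encode u) \<longleftrightarrow> u \<in> T \<and> length t \<le> length u \<and> (\<forall>j<length t. u ! j = t ! j)"
      unfolding E_def by (auto simp: list_encode_eq)
    ultimately show ?thesis by blast
  qed
  have K_iff: "K (list_encode u) (list_encode v) \<longleftrightarrow> kb u v" for u v
    unfolding K_def kb_iff_nth by (rule ex_cong1) (auto simp: le_less)
  have "(list_encode u, list_encode v) \<in> dir_image (kb_order T t) list_encode \<longleftrightarrow>
      (u, v) \<in> kb_order T t" for u v
    by (auto simp: dir_image_def list_encode_eq)
  then have "(list_encode u, list_encode v) \<in> dir_image (kb_order T t) list_encode \<longleftrightarrow>
      E (list_encode u) \<and> E (list_encode v) \<and>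
      (list_encode u = list_encode v \<or> K (list_encode u) (list_encode v))" for u v
    by (auto simp: E_iff K_iff kb_order_def list_encode_eq)
  then have "(x, y) \<in> dir_image (kb_order T t) list_encode \<longleftrightarrow> E x \<and> E y \<and> (x = y \<or> K x y)" for x y
    by (metis list_code_cases)
  moreover have "decidable (\<lambda>z. E (nfst z) \<and> E (nsnd z) \<and> (nfst z = nsnd z \<or> K (nfst z) (nsnd z)))"
    by (intro computable decidable_comp[OF E] K)
  ultimately show ?thesis unfolding decidable_image_prod_encode by simp
qed

section \<open>Ranks of nodes\<close>

text \<open>
  In terms of the usual rank of well-founded trees this says that \<open>t\<close> has rank at least \<open>\<omega> \<alpha>\<close>.
\<close>

function rank_ge :: "nat list set \<Rightarrow> ordinal \<Rightarrow> nat list \<Rightarrow> bool" where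
  "rank_ge T \<alpha> t \<longleftrightarrow>
    (\<forall>\<beta><\<alpha>. \<forall>m\<ge>length t. \<exists>s\<in>level T m. prefix t s \<and> rank_ge T \<beta> s)"
  by auto
termination
  by (relation "inv_image {(\<alpha>, \<beta>). \<alpha> < \<beta>} (\<lambda>(T, \<alpha>, t). \<alpha>)") (auto simp: wf_ordinal)

declare rank_ge.simps [simp del]

lemma rank_geD:
  "rank_ge T \<alpha> t \<Longrightarrow> \<beta> < \<alpha> \<Longrightarrow> length t \<le> m \<Longrightarrow> \<exists>s\<in>level T m. prefix t s \<and> rank_ge T \<beta> s"
  using rank_ge.simps[of T \<alpha> t] by blast

lemma rank_geI:
  "(\<And>\<beta> m. \<beta> < \<alpha> \<Longrightarrow> length t \<le> m \<Longrightarrow> \<exists>s\<in>level T m. prefix t s \<and> rank_ge T \<beta> s) \<Longrightarrow> rank_ge T \<alpha> t"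
  using rank_ge.simps[of T \<alpha> t] by blast

lemma rank_ge_0: "rank_ge T 0 t"
  by (rule rank_geI) (use zero_le_ordinal in \<open>simp add: leD\<close>)

lemma ill_founded_extends:
  assumes "t \<notin> Wellfounded.acc (child_rel T)" "t \<in> T" "length t \<le> m"
  shows "\<exists>s\<in>level T m. prefix t s \<and> s \<notin> Wellfounded.acc (child_rel T)"
  using assms(3)
proof (induction m rule: dec_induct)
  case base
  then show ?case using assms by (auto simp: level_def)
next
  case (step m)
  then obtain s where s: "s \<in> level T m" "prefix t s" "s \<notin> Wellfounded.acc (child_rel T)" by blast
  then obtain u where u: "(u, s) \<in> child_rel T" "u \<notin> Wellfounded.acc (child_rel T)"
    using not_acc_down by metis
  then obtain x where "u = s @ [x]" "u \<in> T" by (auto simp: child_rel_def)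
  then show ?case using s u(2) by (intro bexI[of _ u]) (auto simp: level_def)
qed

text \<open>Ill-foundedness passes on to some extension at every higher level, so no stage of
  \<open>rank_ge\<close> can fail.\<close>

lemma ill_founded_rank_ge:
  "t \<notin> Wellfounded.acc (child_rel T) \<Longrightarrow> t \<in> T \<Longrightarrow> rank_ge T \<gamma> t"
proof (induction \<gamma> arbitrary: t rule: less_induct)
  case (less \<gamma>)
  show ?case
  proof (rule rank_geI)
    fix \<beta> m assume "\<beta> < \<gamma>" "length t \<le> m"
    then show "\<exists>s\<in>level T m. prefix t s \<and> rank_ge T \<beta> s"
      using ill_founded_extends[OF less.prems] less.IH[of \<beta>] by (fastforce simp: level_def)
  qed
qed

text \<open>The rank of a node is bounded by its position \<open>h\<close> in the Kleene-Brouwer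
  order, because every proper extension has a smaller position. These positions lie below the type
  of a computable well-order.\<close>

lemma well_founded_rank_bound:
  assumes T: "computable_tree T" and t: "t \<in> T" "t \<in> Wellfounded.acc (child_rel T)"
  shows "\<not> rank_ge T omega1_CK t"
proof -
  let ?r = "dir_image (kb_order T t) list_encode"
  have tree: "is_tree T" and c: "computable_set (list_encode ` T)"
    using T by (auto simp: computable_tree_def)
  have "kb_order T t =o ?r"
    using Well_order_kb_order[OF tree t(2)]
    by (intro dir_image_ordIso) (auto simp: inj_on_def list_encode_eq)
  then have wo: "Well_order ?r" by (simp add: ordIso_def)
  then obtain \<alpha> where \<alpha>: "has_order_type ?r \<alpha>" using ex_has_order_type by blast
  then have CK: "\<alpha> < omega1_CK"
    using computable_kb_order[OF c] wo unfolding less_omega1_CK_iff computable_ordinal_def by blast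
  obtain h where h: "\<And>x. x \<in> Field ?r \<Longrightarrow> h x < \<alpha>" "\<And>x y. (x, y) \<in> ?r \<Longrightarrow> x \<noteq> y \<Longrightarrow> h x < h y"
    using order_type_rank[OF wo \<alpha>] by metis
  have bound: "\<gamma> \<le> h (list_encode s)" if "s \<in> T" "prefix t s" "rank_ge T \<gamma> s" for \<gamma> s
    using that
  proof (induction \<gamma> arbitrary: s rule: less_induct)
    case (less \<gamma>)
    show ?case
    proof (rule ccontr)
      assume "\<not> ?thesis"
      then have lt: "h (list_encode s) < \<gamma>" by simp
      \<comment> \<open>One level up is enough: any proper extension of s lowers the
        position.\<close>
      then obtain u where u: "u \<in> level T (Suc (length s))" "prefix s u"
          "rank_ge T (h (list_encode s)) u"
        using rank_geD[OF less.prems(3), of _ "Suc (length s)"] by auto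
      have "h (list_encode s) \<le> h (list_encode u)"
        using u less.prems(2) by (intro less.IH[OF lt]) (auto simp: level_def)
      moreover have "h (list_encode u) < h (list_encode s)"
      proof (rule h(2))
        obtain zs where zs: "u = s @ zs" "zs \<noteq> []" using u(1,2) by (fastforce simp: prefix_def level_def)
        then have "kb u s" by (simp add: kb_append_self)
        then have "(u, s) \<in> kb_order T t"
          using u less.prems by (auto simp: kb_order_def level_def)
        then show "(list_encode u, list_encode s) \<in> ?r" by (auto simp: dir_image_def)
        show "list_encode u \<noteq> list_encode s" using zs by (simp add: list_encode_eq)
      qed
      ultimately show False by simp
    qed
  qed
  show ?thesis
  proof
    assume "rank_ge T omega1_CK t"
    then have "omega1_CK \<le> h (list_encode t)" using bound t(1) by blast
    moreover have "h (list_encode t) < \<alpha>"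
      using t(1) by (intro h(1)) (auto simp: dir_image_Field Field_kb_order)
    ultimately show False using CK by simp
  qed
qed

text \<open>By the bound for well-founded nodes, t is ill-founded, hence of every rank. This makes
  the back-and-forth relations stop changing at omega_1^CK.\<close>

lemma rank_ge_omega1_CK:
  assumes "computable_tree T" "t \<in> T" "rank_ge T omega1_CK t"
  shows "rank_ge T \<gamma> t"
  using well_founded_rank_bound[OF assms(1,2)] ill_founded_rank_ge assms(2,3) by blast

section \<open>Back-and-forth relations in the structure of a tree\<close>

text \<open>The group \<open>G_n\<close> without its tag.\<close>

definition finite_level_sets :: "nat list set \<Rightarrow> nat \<Rightarrow> nat list set set" where
  "finite_level_sets T n = {a. finite a \<and> a \<subseteq> level T n}"

lemma tree_group_iff: "(n, a) \<in> tree_group T \<longleftrightarrow> a \<in> finite_level_sets T n"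
  by (simp add: tree_group_def finite_level_sets_def)

lemma finite_level_sets_finite: "a \<in> finite_level_sets T n \<Longrightarrow> finite a"
  by (simp add: finite_level_sets_def)

lemma empty_in_finite_level_sets [simp]: "{} \<in> finite_level_sets T n"
  by (simp add: finite_level_sets_def)

lemma sym_diff_in_finite_level_sets:
  "a \<in> finite_level_sets T n \<Longrightarrow> b \<in> finite_level_sets T n \<Longrightarrow> sym_diff a b \<in> finite_level_sets T n"
  by (auto simp: finite_level_sets_def)

lemma odd_card_sym_diff:
  assumes "finite a" "finite b"
  shows "odd (card (sym_diff a b)) \<longleftrightarrow> odd (card a) \<noteq> odd (card b)"
proof -
  have "card a = card (a - b) + card (a \<inter> b)" "card b = card (b - a) + card (a \<inter> b)"
    using assms by (metis card_Diff_subset_Int card_Int_Diff Int_commute add.commute)+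
  moreover have "card (sym_diff a b) = card (a - b) + card (b - a)"
    using assms by (intro card_Un_disjoint) auto
  ultimately show ?thesis by simp argo
qed

text \<open>Parity of cardinality is additive under symmetric difference, so p is a
  homomorphism.\<close>

lemma parent_sum_sym_diff:
  assumes "finite a" "finite b"
  shows "parent_sum (sym_diff a b) = sym_diff (parent_sum a) (parent_sum b)"
proof -
  have "odd (card {t \<in> sym_diff a b. P t}) \<longleftrightarrow> odd (card {t \<in> a. P t}) \<noteq> odd (card {t \<in> b. P t})" for P
  proof -
    have "{t \<in> sym_diff a b. P t} = sym_diff {t \<in> a. P t} {t \<in> b. P t}" by blast
    then show ?thesis using assms by (simp add: odd_card_sym_diff)
  qed
  then show ?thesis by (auto simp: parent_sum_def simp del: Un_iff Diff_iff)
qed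

lemma parent_sum_child: "s \<in> parent_sum a \<Longrightarrow> \<exists>x. s @ [x] \<in> a"
  unfolding parent_sum_def by (auto dest!: odd_card_imp_not_empty)

lemma finite_parent_sum:
  assumes "finite a"
  shows "finite (parent_sum a)"
proof (rule finite_subset)
  show "parent_sum a \<subseteq> butlast ` a"
    using parent_sum_child by (metis butlast_snoc image_eqI subsetI)
qed (use assms in simp)

lemma parent_sum_finite_level_sets:
  assumes "is_tree T" "a \<in> finite_level_sets T (Suc n)"
  shows "parent_sum a \<in> finite_level_sets T n"
proof -
  have "s \<in> level T n" if s: "s \<in> parent_sum a" for s
  proof -
    obtain x where "s @ [x] \<in> level T (Suc n)"
      using parent_sum_child[OF s] assms(2) by (auto simp: finite_level_sets_def)
    then show ?thesis using assms(1) by (auto simp: level_def is_tree_def)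
  qed
  then show ?thesis using assms(2) finite_parent_sum by (auto simp: finite_level_sets_def)
qed

lemma parent_sum_singleton: "parent_sum {s @ [x]} = {s}"
proof -
  have "{t \<in> {s @ [x]}. \<exists>y. t = u @ [y]} = (if u = s then {s @ [x]} else {})" for u by auto
  then show ?thesis by (auto simp: parent_sum_def split: if_splits)
qed

lemma finite_parent_sum_pow: "finite a \<Longrightarrow> finite ((parent_sum ^^ j) a)"
  by (induction j) (auto simp: finite_parent_sum)

lemma parent_sum_pow_sym_diff:
  assumes "finite a" "finite b"
  shows "(parent_sum ^^ j) (sym_diff a b) = sym_diff ((parent_sum ^^ j) a) ((parent_sum ^^ j) b)"
  using assms by (induction j) (simp_all add: parent_sum_sym_diff finite_parent_sum_pow)

lemma parent_sum_pow_empty [simp]: "(parent_sum ^^ j) {} = {}"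
  by (induction j) (simp_all add: parent_sum_def)

lemma parent_sum_pow_finite_level_sets:
  assumes "is_tree T" "a \<in> finite_level_sets T m" "n \<le> m"
  shows "(parent_sum ^^ (m - n)) a \<in> finite_level_sets T n"
  using assms(3)
proof (induction n rule: inc_induct)
  case base
  then show ?case using assms(2) by simp
next
  case (step n)
  then have "m - n = Suc (m - Suc n)" by simp
  then show ?case using parent_sum_finite_level_sets[OF assms(1) step.IH] by simp
qed

lemma parent_sum_pow_add:
  assumes "k \<le> n" "n \<le> m"
  shows "(parent_sum ^^ (n - k)) ((parent_sum ^^ (m - n)) a) = (parent_sum ^^ (m - k)) a"
  using assms funpow_add[of "n - k" "m - n" parent_sum] by simp

lemma parent_sum_pow_singleton: "(parent_sum ^^ length u) {t @ u} = {t}"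
proof (induction u rule: rev_induct)
  case (snoc x u)
  have "parent_sum {t @ u @ [x]} = {t @ u}" using parent_sum_singleton[of "t @ u" x] by simp
  then show ?case using snoc by (simp add: funpow_swap1 del: funpow.simps(2)) (simp add: funpow_swap1)
qed simp

lemma parent_sum_pow_prefix: "s \<in> (parent_sum ^^ j) a \<Longrightarrow> \<exists>t\<in>a. prefix s t"
proof (induction j arbitrary: s)
  case (Suc j)
  then have "s \<in> parent_sum ((parent_sum ^^ j) a)" by simp
  then obtain x where "s @ [x] \<in> (parent_sum ^^ j) a" using parent_sum_child by blast
  then show ?case using Suc.IH by (meson append_prefixD)
qed auto

text \<open>Each node of g is lifted to one extension satisfying P, and the lifts are added up.
  Symmetric difference instead of union lets the homomorphism property compute the projection;
  cancellation does not hurt, as it only removes nodes.\<close>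

lemma parent_sum_pow_lift:
  assumes "finite g" "\<And>t. t \<in> g \<Longrightarrow> \<exists>s\<in>level T m. prefix t s \<and> P s" "g \<subseteq> level T n"
  shows "\<exists>h\<in>finite_level_sets T m. (parent_sum ^^ (m - n)) h = g \<and> (\<forall>s\<in>h. P s)"
  using assms
proof (induction g)
  case empty
  show ?case by (rule bexI[of _ "{}"]) auto
next
  case (insert t g)
  then obtain h where h: "h \<in> finite_level_sets T m" "(parent_sum ^^ (m - n)) h = g" "\<forall>s\<in>h. P s"
    by auto
  obtain s where s: "s \<in> level T m" "prefix t s" "P s" using insert.prems(1) by blast
  then obtain u where u: "s = t @ u" by (auto simp: prefix_def)
  have "length u = m - n" using u s(1) insert.prems(2) by (auto simp: level_def)
  then have "(parent_sum ^^ (m - n)) {s} = {t}" using parent_sum_pow_singleton[of u t] u by simp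
  then have "(parent_sum ^^ (m - n)) (sym_diff {s} h) = sym_diff {t} g"
    using h by (subst parent_sum_pow_sym_diff) (auto dest: finite_level_sets_finite)
  also have "\<dots> = insert t g" using insert.hyps by blast
  finally have "(parent_sum ^^ (m - n)) (sym_diff {s} h) = insert t g" .
  moreover have "sym_diff {s} h \<in> finite_level_sets T m"
    using s(1) h(1) by (intro sym_diff_in_finite_level_sets) (simp add: finite_level_sets_def)
  moreover have "\<forall>s'\<in>sym_diff {s} h. P s'" using s(3) h(3) by blast
  ultimately show ?case by blast
qed

subsection \<open>Translations\<close>

text \<open>Translation of the levels up to n by the projections of g. Above level n the exponent
  \<open>n - k\<close> is truncated to 0, so the facts about the structure assume
  \<open>fst x \<le> n\<close>.\<close>

definition shift :: "nat \<Rightarrow> nat list set \<Rightarrow> nat \<times> nat list set \<Rightarrow> nat \<times> nat list set" where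
  "shift n g = (\<lambda>(k, b). (k, sym_diff b ((parent_sum ^^ (n - k)) g)))"

lemma fst_shift [simp]: "fst (shift n g x) = fst x"
  by (simp add: shift_def split: prod.split)

lemma shift_shift [simp]: "shift n g (shift n g x) = x"
  by (auto simp: shift_def split: prod.split)

text \<open>Powers of p compose, so a translation given on level m acts on the levels up to n as the
  one given by its projection to level n.\<close>

lemma shift_lift:
  assumes "fst x \<le> n" "n \<le> m"
  shows "shift n ((parent_sum ^^ (m - n)) h) x = shift m h x"
  using assms by (auto simp: shift_def parent_sum_pow_add split: prod.split)

lemma tree_fun_pair: "tree_fun (m, a) (n, b) =
    (min m n, sym_diff ((parent_sum ^^ (m - min m n)) a) ((parent_sum ^^ (n - min m n)) b))"
  by (simp add: tree_fun_def Let_def)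

lemma fst_tree_fun: "fst (tree_fun f x) \<le> fst x"
  by (cases f; cases x) (simp add: tree_fun_pair)

lemma tree_structure_simps [simp]:
  "universe (tree_structure T) = tree_group T"
  "symbols (tree_structure T) = tree_group T"
  "interp (tree_structure T) = tree_fun"
  by (simp_all add: tree_structure_def)

definition top_level :: "(nat \<times> nat list set) list \<Rightarrow> nat \<Rightarrow> bool" where
  "top_level xs n \<longleftrightarrow> n \<in> fst ` set xs \<and> (\<forall>x\<in>set xs. fst x \<le> n)"

lemma ex_top_level: "xs \<noteq> [] \<Longrightarrow> \<exists>n. top_level xs n"
  unfolding top_level_def by (intro exI[of _ "Max (fst ` set xs)"]) auto

context
  fixes T :: "nat list set"
  assumes tree: "is_tree T"
begin

lemma shift_in_tree_group:
  assumes "x \<in> tree_group T" "g \<in> finite_level_sets T n" "fst x \<le> n"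
  shows "shift n g x \<in> tree_group T"
  using assms parent_sum_pow_finite_level_sets[OF tree assms(2)]
  by (cases x) (auto simp: shift_def tree_group_iff intro!: sym_diff_in_finite_level_sets)

lemma map_shift_in_lists:
  assumes "xs \<in> lists (tree_group T)" "g \<in> finite_level_sets T n" "\<forall>x\<in>set xs. fst x \<le> n"
  shows "map (shift n g) xs \<in> lists (tree_group T)"
  using assms shift_in_tree_group by (auto simp: in_lists_conv_set)

lemma tree_fun_in_tree_group:
  assumes "f \<in> tree_group T" "x \<in> tree_group T"
  shows "tree_fun f x \<in> tree_group T"
  using assms parent_sum_pow_finite_level_sets[OF tree]
  by (cases f; cases x) (auto simp: tree_fun_pair tree_group_iff intro!: sym_diff_in_finite_level_sets)

text \<open>Each f_a only projects its argument and adds a constant, and projection takes a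
  translation to its own projection.\<close>

lemma tree_fun_shift:
  assumes "x \<in> tree_group T" "g \<in> finite_level_sets T n" "fst x \<le> n"
  shows "tree_fun f (shift n g x) = shift n g (tree_fun f x)"
proof -
  obtain m a k b where f: "f = (m, a)" and x: "x = (k, b)" by (metis prod.exhaust)
  have fin: "finite b" "finite ((parent_sum ^^ (n - k)) g)"
    using assms x by (auto simp: tree_group_iff dest: finite_level_sets_finite intro!: finite_parent_sum_pow)
  let ?j = "min m k"
  have "(parent_sum ^^ (k - ?j)) ((parent_sum ^^ (n - k)) g) = (parent_sum ^^ (n - ?j)) g"
    using assms(3) x by (intro parent_sum_pow_add) auto
  then have "(parent_sum ^^ (k - ?j)) (sym_diff b ((parent_sum ^^ (n - k)) g)) =
      sym_diff ((parent_sum ^^ (k - ?j)) b) ((parent_sum ^^ (n - ?j)) g)"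
    using fin by (simp add: parent_sum_pow_sym_diff)
  then show ?thesis by (simp add: f x shift_def tree_fun_pair) blast
qed

lemma term_val_shift:
  assumes "xs \<in> lists (tree_group T)" "g \<in> finite_level_sets T n" "\<forall>x\<in>set xs. fst x \<le> n"
    and "t \<in> terms (tree_structure T) (length xs)"
  shows "term_val (tree_structure T) xs t \<in> tree_group T \<and> fst (term_val (tree_structure T) xs t) \<le> n \<and>
    term_val (tree_structure T) (map (shift n g) xs) t = shift n g (term_val (tree_structure T) xs t)"
  using assms(4)
proof (induction rule: terms.induct)
  case (1 i)
  then show ?case using assms by (auto simp: in_lists_conv_set)
next
  case (2 f t)
  then show ?case
    using assms(2) tree_fun_in_tree_group tree_fun_shift fst_tree_fun[of f "term_val (tree_structure T) xs t"]
    by simp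
qed

text \<open>Equations f_a(x_i) = x_j suffice to find the translation: every entry is the image under
  some f_a of one fixed entry on the top level, and f_a carries the displacement of that entry
  along. Conversely, translations are injective and commute with all terms.\<close>

lemma same_atomic_iff:
  assumes xs: "xs \<in> lists (tree_group T)" and ys: "ys \<in> lists (tree_group T)"
    and n: "top_level xs n"
  shows "same_atomic (tree_structure T) xs ys \<longleftrightarrow> (\<exists>g\<in>finite_level_sets T n. ys = map (shift n g) xs)"
proof
  assume "\<exists>g\<in>finite_level_sets T n. ys = map (shift n g) xs"
  then obtain g where g: "g \<in> finite_level_sets T n" "ys = map (shift n g) xs" by blast
  have inj: "shift n g x = shift n g y \<longleftrightarrow> x = y" for x y by (metis shift_shift)
  have le: "\<forall>x\<in>set xs. fst x \<le> n" using n by (simp add: top_level_def)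
  show "same_atomic (tree_structure T) xs ys"
    unfolding same_atomic_def g(2) using term_val_shift[OF xs g(1) le] by (simp add: inj)
next
  assume sa: "same_atomic (tree_structure T) xs ys"
  then have len: "length ys = length xs" by (simp add: same_atomic_def)
  have eq: "tree_fun f (xs ! i) = xs ! j \<longleftrightarrow> tree_fun f (ys ! i) = ys ! j"
    if "f \<in> tree_group T" "i < length xs" "j < length xs" for f i j
  proof -
    have "App f (Var i) \<in> terms (tree_structure T) (length xs)" "Var j \<in> terms (tree_structure T) (length xs)"
      using that by (auto intro!: terms.intros)
    then show ?thesis using sa unfolding same_atomic_def by fastforce
  qed
  have mem: "xs ! i \<in> tree_group T" "ys ! i \<in> tree_group T" if "i < length xs" for i
    using xs ys len that by (auto simp: in_lists_conv_set)
  \<comment> \<open>The identity of level k fixes exactly the elements of level at most k, so atomic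
    formulas determine the level of an entry.\<close>
  have fix_iff: "tree_fun (k, {}) x = x \<longleftrightarrow> fst x \<le> k" for k x
    by (cases x) (auto simp: tree_fun_pair min_def)
  have lev: "fst (ys ! i) = fst (xs ! i)" if "i < length xs" for i
    using eq[OF _ that that, of "(fst (xs ! i), {})"] eq[OF _ that that, of "(fst (ys ! i), {})"]
    by (simp add: fix_iff tree_group_iff)
  obtain i0 where i0: "i0 < length xs" "fst (xs ! i0) = n"
    using n by (auto simp: top_level_def in_set_conv_nth)
  obtain b0 where b0: "xs ! i0 = (n, b0)" using i0(2) by (cases "xs ! i0") auto
  obtain c0 where c0: "ys ! i0 = (n, c0)" using i0 lev[OF i0(1)] by (cases "ys ! i0") auto
  have bc: "b0 \<in> finite_level_sets T n" "c0 \<in> finite_level_sets T n"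
    using mem[OF i0(1)] b0 c0 by (simp_all add: tree_group_iff)
  define g where "g = sym_diff b0 c0"
  have "ys ! i = shift n g (xs ! i)" if i: "i < length xs" for i
  proof -
    obtain k b where kb: "xs ! i = (k, b)" by (metis prod.exhaust)
    have k: "k \<le> n" using n i kb by (metis top_level_def fst_conv nth_mem)
    have b: "b \<in> finite_level_sets T k" using mem(1)[OF i] kb by (simp add: tree_group_iff)
    define p where "p = (parent_sum ^^ (n - k))"
    have p: "p b0 \<in> finite_level_sets T k"
      unfolding p_def using parent_sum_pow_finite_level_sets[OF tree bc(1) k] .
    \<comment> \<open>Chosen so that the function symbol takes the top entry \<open>b0\<close> to
      \<open>b\<close>: it cancels the projection of \<open>b0\<close>.\<close>
    let ?f = "(k, sym_diff b (p b0))"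
    have f: "?f \<in> tree_group T"
      using sym_diff_in_finite_level_sets[OF b p] by (simp add: tree_group_iff)
    have "tree_fun ?f (xs ! i0) = xs ! i"
      using k by (simp add: b0 kb tree_fun_pair p_def min_absorb1) blast
    then have "ys ! i = tree_fun ?f (ys ! i0)" using eq[OF f i0(1) i] by simp
    also have "\<dots> = (k, sym_diff (sym_diff b (p b0)) (p c0))"
      using k by (simp add: c0 tree_fun_pair p_def min_absorb1)
    also have "\<dots> = (k, sym_diff b (p g))"
      using bc by (simp add: g_def p_def parent_sum_pow_sym_diff finite_level_sets_finite) blast
    finally show ?thesis by (simp add: kb shift_def p_def)
  qed
  then have "ys = map (shift n g) xs" using len by (intro nth_equalityI) auto
  moreover have "g \<in> finite_level_sets T n"
    unfolding g_def using bc by (rule sym_diff_in_finite_level_sets)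
  ultimately show "\<exists>g\<in>finite_level_sets T n. ys = map (shift n g) xs" by blast
qed

text \<open>A challenge may put an entry on any level m, and answering it amounts to lifting the
  translation from level n to level m. The possibility of such lifts, stage by stage, is what
  \<open>rank_ge\<close> records.\<close>

lemma back_forth_iff:
  assumes "xs \<in> lists (tree_group T)" "ys \<in> lists (tree_group T)" "top_level xs n"
  shows "back_forth (tree_structure T) \<alpha> xs ys \<longleftrightarrow>
    (\<exists>g\<in>finite_level_sets T n. ys = map (shift n g) xs \<and> (\<forall>t\<in>g. rank_ge T \<alpha> t))"
  using assms
proof (induction \<alpha> arbitrary: xs ys n rule: less_induct)
  case (less \<alpha>)
  note xs = less.prems(1) and ys = less.prems(2) and n = less.prems(3)
  show ?case
  proof (cases "\<alpha> = 0")
    case True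
    then show ?thesis
      using same_atomic_iff[OF less.prems] rank_ge_0 by (simp add: back_forth.simps[of "tree_structure T" 0])
  next
    case False
    then have pos: "\<alpha> > 0" using zero_le_ordinal[of \<alpha>] by (simp add: order.strict_iff_order)
    show ?thesis
    proof
      assume bf: "back_forth (tree_structure T) \<alpha> xs ys"
      \<comment> \<open>Stage 0 already yields the translation; only the ranks of its nodes
        remain.\<close>
      then have "back_forth (tree_structure T) 0 xs ys" using back_forth_antimono zero_le_ordinal by blast
      then obtain g where g: "g \<in> finite_level_sets T n" "ys = map (shift n g) xs"
        using less.IH[OF pos less.prems] by blast
      have "rank_ge T \<alpha> t" if t: "t \<in> g" for t
      proof (rule rank_geI)
        fix \<beta> m assume \<beta>: "\<beta> < \<alpha>" and "length t \<le> m"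
        then have m: "n \<le> m" using t g(1) by (auto simp: finite_level_sets_def level_def)
        \<comment> \<open>The challenge is the identity of level m: an answer comes with a
          translation h on level m, and comparing on the old entries shows that h projects to
          g.\<close>
        let ?z = "(m, {} :: nat list set)"
        have z: "[?z] \<in> tuples (tree_structure T)" by (simp add: tree_group_iff)
        then obtain ws where ws: "ws \<in> tuples (tree_structure T)" "back_forth (tree_structure T) \<beta> (xs @ [?z]) (ys @ ws)"
          using bf \<beta> unfolding back_forth_pos[OF pos] by blast
        have top: "top_level (xs @ [?z]) m" using n m by (auto simp: top_level_def)
        obtain h where h: "h \<in> finite_level_sets T m" "ys @ ws = map (shift m h) (xs @ [?z])"
            "\<forall>s\<in>h. rank_ge T \<beta> s"
          using less.IH[OF \<beta> _ _ top] xs ys z ws by (auto simp: append_in_lists_conv)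
        obtain x where x: "x \<in> set xs" "fst x = n" using n by (auto simp: top_level_def)
        have "map (shift n g) xs = map (shift m h) xs" using h(2) g(2) by (auto simp: append_eq_append_conv)
        then have "shift n g x = shift m h x" using x(1) by simp
        also have "\<dots> = shift n ((parent_sum ^^ (m - n)) h) x" using x(2) m by (simp add: shift_lift)
        \<comment> \<open>An entry on level n itself is displaced by exactly g, so it determines
          g.\<close>
        finally have "g = (parent_sum ^^ (m - n)) h" using x(2) by (cases x) (auto simp: shift_def)
        then obtain s where "s \<in> h" "prefix t s" using t parent_sum_pow_prefix by blast
        then show "\<exists>s\<in>level T m. prefix t s \<and> rank_ge T \<beta> s"
          using h(1,3) by (auto simp: finite_level_sets_def)
      qed
      then show "\<exists>g\<in>finite_level_sets T n. ys = map (shift n g) xs \<and> (\<forall>t\<in>g. rank_ge T \<alpha> t)"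
        using g by blast
    next
      assume "\<exists>g\<in>finite_level_sets T n. ys = map (shift n g) xs \<and> (\<forall>t\<in>g. rank_ge T \<alpha> t)"
      then obtain g where g: "g \<in> finite_level_sets T n" "ys = map (shift n g) xs"
          "\<forall>t\<in>g. rank_ge T \<alpha> t" by blast
      \<comment> \<open>One answer serves both directions, because a translation is its own
        inverse.\<close>
      have step: "\<exists>ws\<in>tuples (tree_structure T). length ws = length zs \<and> back_forth (tree_structure T) \<beta> (xs @ zs) (ys @ ws) \<and>
          back_forth (tree_structure T) \<beta> (xs @ ws) (ys @ zs)"
        if \<beta>: "\<beta> < \<alpha>" and zs: "zs \<in> tuples (tree_structure T)" for \<beta> zs
      proof -
        have "xs \<noteq> []" using n by (auto simp: top_level_def)
        then obtain m where m: "top_level (xs @ zs) m" using ex_top_level[of "xs @ zs"] by auto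
        have nm: "n \<le> m" using m n by (auto simp: top_level_def)
        have "\<exists>s\<in>level T m. prefix t s \<and> rank_ge T \<beta> s" if "t \<in> g" for t
          using that g nm \<beta> by (intro rank_geD[of T \<alpha>]) (auto simp: finite_level_sets_def level_def)
        then obtain h where h: "h \<in> finite_level_sets T m" "(parent_sum ^^ (m - n)) h = g"
            "\<forall>s\<in>h. rank_ge T \<beta> s"
          using parent_sum_pow_lift[of g T m "rank_ge T \<beta>" n] g(1)
          by (auto simp: finite_level_sets_def)
        define ws where "ws = map (shift m h) zs"
        have ys_eq: "ys = map (shift m h) xs"
          unfolding g(2) h(2)[symmetric] using n nm by (auto simp: top_level_def shift_lift)
        have ws: "ws \<in> lists (tree_group T)"
          unfolding ws_def using zs h(1) m by (intro map_shift_in_lists) (auto simp: top_level_def)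
        have "back_forth (tree_structure T) \<beta> (xs @ zs) (ys @ ws)"
          using less.IH[OF \<beta> _ _ m, of "ys @ ws"] xs ys zs ws h(1,3)
          by (auto simp: append_in_lists_conv ys_eq ws_def)
        moreover have m': "top_level (xs @ ws) m"
          using m by (simp add: top_level_def ws_def image_Un image_image ball_Un)
        moreover have "back_forth (tree_structure T) \<beta> (xs @ ws) (ys @ zs)"
          using less.IH[OF \<beta> _ _ m', of "ys @ zs"] xs ys zs ws h(1,3)
          by (auto simp: append_in_lists_conv ys_eq ws_def comp_def)
        ultimately show ?thesis using ws by (intro bexI[of _ ws]) (auto simp: ws_def)
      qed
      then show "back_forth (tree_structure T) \<alpha> xs ys" unfolding back_forth_pos[OF pos] by metis
    qed
  qed
qed

end

section \<open>The Scott rank of the structure of a tree\<close>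

lemma back_forth_refl: "back_forth M \<alpha> xs xs"
proof (induction \<alpha> arbitrary: xs rule: less_induct)
  case (less \<alpha>)
  then show ?case by (subst back_forth.simps) (auto simp: same_atomic_def)
qed

text \<open>The upper bound is \<open>rank_ge_omega1_CK\<close>. For the lower bound, translating
  the identity of level n by \<open>{t}\<close> tests the rank of the single node t.\<close>

lemma scott_rank_tree_structure:
  assumes T: "computable_tree T"
    and unbounded: "\<And>\<beta>. \<beta> < omega1_CK \<Longrightarrow> \<exists>t\<in>level T n. rank_ge T \<beta> t \<and> \<not> rank_ge T omega1_CK t"
  shows "scott_rank (tree_structure T) = ordinal_suc omega1_CK"
proof -
  let ?M = "tree_structure T"
  have tree: "is_tree T" using T by (simp add: computable_tree_def)
  note bf_iff = back_forth_iff[OF tree]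
  have stable: "back_forth ?M \<gamma> xs ys"
    if xy: "xs \<in> tuples ?M" "ys \<in> tuples ?M" "length ys = length xs" "back_forth ?M omega1_CK xs ys"
    for xs ys \<gamma>
  \<comment> \<open>The empty tuple has no top level, but the only tuple of its length is
    itself.\<close>
  proof (cases "xs = []")
    case True
    then show ?thesis using xy(3) by (simp add: back_forth_refl)
  next
    case False
    then obtain m where m: "top_level xs m" using ex_top_level by blast
    obtain g where g: "g \<in> finite_level_sets T m" "ys = map (shift m g) xs"
        "\<forall>t\<in>g. rank_ge T omega1_CK t"
      using bf_iff[of xs ys m omega1_CK] xy m by auto
    have "\<forall>t\<in>g. rank_ge T \<gamma> t"
      using g(1,3) rank_ge_omega1_CK[OF T] by (auto simp: finite_level_sets_def level_def)
    then show ?thesis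
      using bf_iff[of xs ys m \<gamma>] xy g m by auto
  qed
  then have le: "tuple_rank ?M xs \<le> omega1_CK" if "xs \<in> tuples ?M" for xs
    unfolding tuple_rank_def using that by (intro Least_le) blast
  define xs where "xs = [(n, {} :: nat list set)]"
  have xs: "xs \<in> lists (tree_group T)" by (simp add: xs_def tree_group_iff)
  have top: "top_level xs n" by (simp add: top_level_def xs_def)
  have ge: "omega1_CK \<le> tuple_rank ?M xs"
  proof (rule ccontr)
    assume "\<not> ?thesis"
    then have lt: "tuple_rank ?M xs < omega1_CK" by simp
    then obtain t where t: "t \<in> level T n" "rank_ge T (tuple_rank ?M xs) t"
        "\<not> rank_ge T omega1_CK t"
      using unbounded by blast
    define ys where "ys = [(n, {t})]"
    have ys: "ys \<in> lists (tree_group T)" using t(1) by (simp add: ys_def tree_group_def)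
    have shift: "ys = map (shift n g) xs \<longleftrightarrow> g = {t}" for g
      by (auto simp: xs_def ys_def shift_def)
    have "back_forth ?M (tuple_rank ?M xs) xs ys"
      using t by (simp add: bf_iff[OF xs ys top] shift finite_level_sets_def)
    moreover have "\<forall>ys \<in> tuples ?M. length ys = length xs \<longrightarrow>
        back_forth ?M (tuple_rank ?M xs) xs ys \<longrightarrow> (\<forall>\<gamma>>tuple_rank ?M xs. back_forth ?M \<gamma> xs ys)"
      unfolding tuple_rank_def
      by (rule LeastI[of _ omega1_CK]) (use stable xs in simp)
    ultimately have "back_forth ?M omega1_CK xs ys"
      using lt ys by (simp add: xs_def ys_def)
    then show False
      using t(3) by (simp add: bf_iff[OF xs ys top] shift)
  qed
  show ?thesis
    unfolding scott_rank_def
  proof (rule Least_equality)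
    show "\<forall>xs\<in>tuples ?M. tuple_rank ?M xs < ordinal_suc omega1_CK"
      using le less_ordinal_suc le_less_trans by blast
    fix \<alpha> assume "\<forall>xs\<in>tuples ?M. tuple_rank ?M xs < \<alpha>"
    then have "tuple_rank ?M xs < \<alpha>" using xs by simp
    with ge have "omega1_CK < \<alpha>" by (rule le_less_trans)
    then show "ordinal_suc omega1_CK \<le> \<alpha>" unfolding ordinal_suc_def by (rule Least_le)
  qed
qed

section \<open>The universal tree of descending sequences\<close>

inductive_cases evaluates_ZeroE: "evaluates Zero_fn xs y"
inductive_cases evaluates_SucE: "evaluates Suc_fn xs y"
inductive_cases evaluates_ProjE: "evaluates (Proj_fn i) xs y"
inductive_cases evaluates_CompE: "evaluates (Comp_fn f gs) xs y"
inductive_cases evaluates_Prec_0E: "evaluates (Prec_fn f g) (0 # xs) y"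
inductive_cases evaluates_Prec_SucE: "evaluates (Prec_fn f g) (Suc n # xs) y"
inductive_cases evaluates_MuE: "evaluates (Mu_fn f) xs y"

text \<open>Ensures that a certificate for the value 1 cannot exist when the program answers 0. For
  \<open>Mu_fn\<close>, two different results would give the smaller one both a zero and a positive
  value.\<close>

lemma evaluates_functional: "evaluates f xs y \<Longrightarrow> evaluates f xs z \<Longrightarrow> y = z"
proof (induction arbitrary: z rule: evaluates.induct)
  case (Zero xs)
  then show ?case by (rule evaluates_ZeroE) simp
next
  case (Suc x)
  then show ?case by (rule evaluates_SucE) simp
next
  case (Proj i xs)
  from Proj.prems show ?case by (rule evaluates_ProjE) simp
next
  case (Comp xs gs ys f z z')
  from Comp.prems obtain ys' where ys': "list_all2 (\<lambda>g y. evaluates g xs y) gs ys'" "evaluates f ys' z'"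
    by (rule evaluates_CompE)
  have "ys = ys'"
    using Comp.IH(1) ys'(1) by (intro nth_equalityI) (auto simp: list_all2_conv_all_nth)
  then show ?case using Comp.IH(2) ys'(2) by simp
next
  case (Prec_0 f xs y g)
  from Prec_0.prems show ?case by (rule evaluates_Prec_0E) (rule Prec_0.IH)
next
  case (Prec_Suc f g n xs y z z')
  from Prec_Suc.prems obtain y' where y': "evaluates (Prec_fn f g) (n # xs) y'"
      "evaluates g (n # y' # xs) z'"
    by (rule evaluates_Prec_SucE)
  from Prec_Suc.IH(1)[OF y'(1)] y'(2) show ?case by (simp add: Prec_Suc.IH(2))
next
  case (Mu f n xs)
  from Mu.prems obtain z: "evaluates f (z # xs) 0" "\<forall>m<z. \<exists>y>0. evaluates f (m # xs) y"
    by (rule evaluates_MuE)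
  show ?case
  proof (rule linorder_cases[of n z])
    assume "n < z"
    then obtain y where "y > 0" "evaluates f (n # xs) y" using z(2) by blast
    then show ?thesis using Mu.IH(1)[of y] by simp
  next
    assume "z < n"
    then obtain y where "y > 0" "\<forall>y'. evaluates f (z # xs) y' \<longrightarrow> y = y'" using Mu.IH(2) by blast
    then show ?thesis using z(1) by blast
  qed
qed

text \<open>
  An entry \<open>u\<close> of a descending sequence consists of a point \<open>nfst u\<close> of the order, a counter
  \<open>nfst (nsnd u)\<close> and a certificate \<open>nsnd (nsnd u)\<close> that the point lies below the previous one.
  The counters turn an order of type \<open>\<alpha>\<close> into one of type \<open>\<omega> \<alpha>\<close>.
\<close>

definition descent_step :: "nat \<Rightarrow> nat \<Rightarrow> nat \<Rightarrow> bool" where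
  "descent_step e u v \<longleftrightarrow>
    nfst v = nfst u \<and> nfst (nsnd v) < nfst (nsnd u) \<or>
    nfst v \<noteq> nfst u \<and> certifies (list_decode (nsnd (nsnd v))) e [prod_encode (nfst v, nfst u)] 1"

text \<open>Entry 0 is the program and entry 1 an unrestricted starting point, so comparisons begin
  at index 1. A starting point outside the field of the order does no harm: from there only the
  counter can decrease.\<close>

definition descent_tree :: "nat list set" where
  "descent_tree = {s. \<forall>i. Suc (Suc i) < length s \<longrightarrow>
    descent_step (s ! 0) (s ! Suc i) (s ! Suc (Suc i))}"

lemma computable_descent_tree: "computable_tree descent_tree"
proof -
  have "is_tree descent_tree"
    unfolding is_tree_def
  proof (intro ballI allI impI)
    fix t s assume "t \<in> descent_tree" "prefix s t"
    then obtain zs where "s @ zs \<in> descent_tree" by (auto simp: prefix_def)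
    then have step: "\<forall>i. Suc (Suc i) < length (s @ zs) \<longrightarrow>
        descent_step ((s @ zs) ! 0) ((s @ zs) ! Suc i) ((s @ zs) ! Suc (Suc i))"
      by (simp add: descent_tree_def)
    have "descent_step (s ! 0) (s ! Suc i) (s ! Suc (Suc i))" if "Suc (Suc i) < length s" for i
      using that step[rule_format, of i] by (cases s) (auto simp: nth_append)
    then show "s \<in> descent_tree" by (simp add: descent_tree_def)
  qed
  moreover have "computable_set (list_encode ` descent_tree)"
  proof -
    \<comment> \<open>Expresses the code of the argument list in \<open>certifies\<close> through
      \<open>ccons\<close>, which is known to be computable.\<close>
    have "list_encode [x] = ccons x 0" for x by (simp add: ccons_def list_encode.simps)
    then have "decidable (\<lambda>z. descent_step (nfst z) (nfst (nsnd z)) (nsnd (nsnd z)))"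
      unfolding descent_step_def certifies_def eval_code_def
      by (simp only:) (intro computable)
    \<comment> \<open>Pairing the last two arguments turns the ternary predicate into a binary one,
      as \<open>decidable_comp2\<close> expects.\<close>
    then have step: "decidable (\<lambda>z. (\<lambda>e w. descent_step e (nfst w) (nsnd w)) (nfst z) (nsnd z))"
      by simp
    have "decidable (\<lambda>c. \<forall>i<clength c. Suc (Suc i) < clength c \<longrightarrow>
        (\<lambda>e w. descent_step e (nfst w) (nsnd w)) (cnth c 0)
          (prod_encode (cnth c (Suc i), cnth c (Suc (Suc i)))))"
      by (intro decidable_all_less decidable_imp decidable_comp2[OF step] computable)
    moreover have "c \<in> list_encode ` descent_tree \<longleftrightarrow> (\<forall>i<clength c. Suc (Suc i) < clength c \<longrightarrow>
        descent_step (cnth c 0) (cnth c (Suc i)) (cnth c (Suc (Suc i))))" for c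
    proof (cases c rule: list_code_cases)
      case (1 s)
      have "c \<in> list_encode ` descent_tree \<longleftrightarrow> s \<in> descent_tree"
        using 1 by (auto simp: list_encode_eq)
      also have "\<dots> \<longleftrightarrow> (\<forall>i<length s. Suc (Suc i) < length s \<longrightarrow>
          descent_step (s ! 0) (s ! Suc i) (s ! Suc (Suc i)))"
        by (auto simp: descent_tree_def)
      also have "\<dots> \<longleftrightarrow> (\<forall>i<clength c. Suc (Suc i) < clength c \<longrightarrow>
          descent_step (cnth c 0) (cnth c (Suc i)) (cnth c (Suc (Suc i))))"
        using 1 clength_list_encode[of "[]"] by (cases "s = []") auto
      finally show ?thesis .
    qed
    ultimately show ?thesis by (simp add: computable_set_iff_decidable)
  qed
  ultimately show ?thesis by (simp add: computable_tree_def)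
qed

lemma descent_tree_short: "length s \<le> 2 \<Longrightarrow> s \<in> descent_tree"
  by (auto simp: descent_tree_def)

lemma descent_tree_snoc:
  assumes "s \<in> descent_tree" "2 \<le> length s"
  shows "s @ [v] \<in> descent_tree \<longleftrightarrow> descent_step (hd s) (last s) v"
proof -
  obtain e us u where s: "s = e # us @ [u]"
    using assms(2) by (metis Suc_le_length_iff numeral_2_eq_2 rev_exhaust list.distinct(1))
  have "s @ [v] \<in> descent_tree \<longleftrightarrow> (\<forall>i<length s - 1.
      descent_step ((s @ [v]) ! 0) ((s @ [v]) ! Suc i) ((s @ [v]) ! Suc (Suc i)))"
    using assms(2) by (auto simp: descent_tree_def)
  also have "\<dots> \<longleftrightarrow> (\<forall>i<length us. descent_step (s ! 0) (s ! Suc i) (s ! Suc (Suc i))) \<and>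
      descent_step (hd s) (last s) v"
  proof -
    have "(s @ [v]) ! j = s ! j" if "j < length s" for j
      using that by (rule nth_append_left)
    moreover have "length s - 1 = Suc (length us)" by (simp add: s)
    moreover have "(s @ [v]) ! Suc (Suc (length us)) = v" by (simp add: s nth_append)
    moreover have "s ! Suc (length us) = last s" "s ! 0 = hd s" by (simp_all add: s)
    moreover have "length s = Suc (Suc (length us))" by (simp add: s)
    ultimately show ?thesis by (simp only: All_less_Suc) (auto simp: less_SucI)
  qed
  also have "(\<forall>i<length us. descent_step (s ! 0) (s ! Suc i) (s ! Suc (Suc i))) \<longleftrightarrow> s \<in> descent_tree"
    by (auto simp: descent_tree_def s)
  finally show ?thesis using assms(1) by blast
qed

text \<open>The counter of the last entry is a supply of further levels that can be used without
  leaving the point; this is how a prescribed level is reached.\<close>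

lemma descent_tree_count_down:
  assumes "s \<in> descent_tree" "2 \<le> length s" "j \<le> nfst (nsnd (last s))"
  shows "\<exists>s'\<in>level descent_tree (length s + j). prefix s s' \<and> nfst (last s') = nfst (last s) \<and>
    nfst (nsnd (last s')) = nfst (nsnd (last s)) - j"
  using assms(3)
proof (induction j)
  case 0
  show ?case by (rule bexI[of _ s]) (use assms in \<open>auto simp: level_def\<close>)
next
  case (Suc j)
  then obtain s' where s': "s' \<in> level descent_tree (length s + j)" "prefix s s'"
      "nfst (last s') = nfst (last s)" "nfst (nsnd (last s')) = nfst (nsnd (last s)) - j"
    by auto
  \<comment> \<open>The certificate is 0, since a step that keeps the point needs none.\<close>
  define v where "v = prod_encode (nfst (last s), prod_encode (nfst (nsnd (last s)) - Suc j, 0))"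
  have "descent_step (hd s') (last s') v"
    using s'(3,4) Suc.prems by (simp add: descent_step_def v_def)
  then have "s' @ [v] \<in> descent_tree"
    using s'(1) assms(2) by (simp add: descent_tree_snoc level_def)
  then show ?case
    using s'(1,2) by (intro bexI[of _ "s' @ [v]"]) (auto simp: level_def v_def)
qed

section \<open>The subtree above a program that decides a well-order\<close>

context
  fixes r :: "nat rel" and f :: recf
  assumes wo: "Well_order r"
    and f: "\<And>z. evaluates f [z] (if z \<in> prod_encode ` r then 1 else 0)"
begin

lemma evaluates_1_iff: "evaluates f [prod_encode (x, y)] 1 \<longleftrightarrow> (x, y) \<in> r"
proof -
  have "prod_encode (x, y) \<in> prod_encode ` r \<longleftrightarrow> (x, y) \<in> r" by auto
  then show ?thesis
    using f[of "prod_encode (x, y)"] evaluates_functional[of f "[prod_encode (x, y)]" 0 1]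
    by (auto split: if_splits)
qed

text \<open>Completeness of certificates removes them from view: what remains is a lexicographic
  descent, in which a new point may bring any counter.\<close>

lemma descent_step_iff:
  "(\<exists>L. descent_step (recf_code f) u (prod_encode (y, prod_encode (k, L)))) \<longleftrightarrow>
    y = nfst u \<and> k < nfst (nsnd u) \<or> y \<noteq> nfst u \<and> (y, nfst u) \<in> r"
proof -
  have "(\<exists>L. certifies (list_decode L) (recf_code f) [z] 1) \<longleftrightarrow> evaluates f [z] 1" for z
    unfolding evaluates_iff_certifies by (metis list_encode_inverse)
  then show ?thesis
    by (simp add: descent_step_def ex_disj_distrib evaluates_1_iff del: One_nat_def)
qed

text \<open>Each step lowers the pair of point and counter lexicographically in the well-founded
  product of \<open>r - Id\<close> and the order of the naturals.\<close>

lemma descent_tree_well_founded: "[recf_code f] \<in> Wellfounded.acc (child_rel descent_tree)"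
proof -
  define e where "e = recf_code f"
  define \<phi> where "\<phi> s = (nfst (last s), nfst (nsnd (last s)))" for s
  have "wf ((r - Id) <*lex*> less_than)"
    using wo by (auto simp: well_order_on_def)
  then have acc: "hd s = e \<Longrightarrow> 2 \<le> length s \<Longrightarrow> s \<in> Wellfounded.acc (child_rel descent_tree)" for s
  proof (induction "\<phi> s" arbitrary: s rule: wf_induct_rule)
    case less
    show ?case
    proof (rule accI)
      fix u assume "(u, s) \<in> child_rel descent_tree"
      then obtain v where u: "u = s @ [v]" "s @ [v] \<in> descent_tree" by (auto simp: child_rel_def)
      then have "s \<in> descent_tree"
        using computable_descent_tree by (auto simp: computable_tree_def is_tree_def)
      then have "descent_step e (last s) v"
        using u less.prems by (simp add: descent_tree_snoc)
      then have "\<exists>L. descent_step (recf_code f) (last s)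
          (prod_encode (nfst v, prod_encode (nfst (nsnd v), L)))"
        by (intro exI[of _ "nsnd (nsnd v)"]) (simp add: e_def)
      then have "(\<phi> u, \<phi> s) \<in> (r - Id) <*lex*> less_than"
        unfolding descent_step_iff by (auto simp: \<phi>_def u(1))
      then show "u \<in> Wellfounded.acc (child_rel descent_tree)"
        using less.prems by (intro less.hyps) (auto simp: u(1) hd_append)
    qed
  qed
  \<comment> \<open>The node of length 1 has no point yet, and its children choose one freely, so it
    takes a separate step.\<close>
  show ?thesis
  proof (rule accI)
    fix u assume "(u, [recf_code f]) \<in> child_rel descent_tree"
    then show "u \<in> Wellfounded.acc (child_rel descent_tree)"
      by (intro acc) (auto simp: child_rel_def e_def)
  qed
qed

text \<open>A node with last point x has rank at least \<open>h x\<close>: to reach level m with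
  rank \<delta>, move to the point y with \<open>h y = \<delta>\<close> and count down until level
  m, still at y.\<close>

lemma descent_tree_rank_ge:
  assumes \<alpha>: "has_order_type r \<alpha>"
  shows "rank_ge descent_tree \<alpha> [recf_code f]"
proof -
  obtain h where h: "\<And>x. x \<in> Field r \<Longrightarrow> h x < \<alpha>"
      "\<And>x y. (x, y) \<in> r \<Longrightarrow> x \<noteq> y \<Longrightarrow> h x < h y"
      "\<And>\<beta>. \<beta> < \<alpha> \<Longrightarrow> \<exists>x\<in>Field r. h x = \<beta>"
    using order_type_rank[OF wo \<alpha>] by metis
  have below: "(y, x) \<in> r \<and> y \<noteq> x" if "x \<in> Field r" "y \<in> Field r" "h y < h x" for x y
  proof -
    have "x \<noteq> y" using that(3) by blast
    moreover have "(x, y) \<notin> r" using h(2)[of x y] \<open>x \<noteq> y\<close> that(3) less_not_sym by blast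
    ultimately show ?thesis
      using wo that(1,2) by (auto simp: well_order_on_def linear_order_on_def total_on_def)
  qed
  have extend: "\<exists>s'\<in>level descent_tree m. prefix s s' \<and> nfst (last s') = y"
    if s: "s \<noteq> []" "\<And>k. \<exists>L. s @ [prod_encode (y, prod_encode (k, L))] \<in> descent_tree"
      and m: "length s < m" for s y m
  proof -
    \<comment> \<open>The counter is the number of levels left after this entry, so that it can be
      counted down to level m.\<close>
    obtain L where L: "s @ [prod_encode (y, prod_encode (m - Suc (length s), L))] \<in> descent_tree"
      using s(2) by blast
    then show ?thesis
      using descent_tree_count_down[OF L, of "m - Suc (length s)"] s(1) m
      by (auto simp: Suc_le_eq dest: append_prefixD)
  qed
  have nonroot: "rank_ge descent_tree \<gamma> s"
    if "s \<in> descent_tree" "hd s = recf_code f" "2 \<le> length s" "nfst (last s) \<in> Field r"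
      "\<gamma> \<le> h (nfst (last s))" for \<gamma> s
    using that
  proof (induction \<gamma> arbitrary: s rule: less_induct)
    case (less \<gamma>)
    let ?x = "nfst (last s)"
    show ?case
    proof (rule rank_geI)
      fix \<delta> m assume \<delta>: "\<delta> < \<gamma>" and m: "length s \<le> m"
      have lt: "\<delta> < h ?x" using \<delta> less.prems(5) by simp
      show "\<exists>s'\<in>level descent_tree m. prefix s s' \<and> rank_ge descent_tree \<delta> s'"
      \<comment> \<open>On the level of s only s itself qualifies, which is covered by the induction
        on the ordinal.\<close>
      proof (cases "m = length s")
        case True
        then show ?thesis
          using less.IH[OF \<delta> less.prems(1-4)] lt less.prems(1)
          by (intro bexI[of _ s]) (auto simp: level_def)
      next
        case False
        have "\<delta> < \<alpha>" using lt h(1)[OF less.prems(4)] by simp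
        then obtain y where y: "y \<in> Field r" "h y = \<delta>" using h(3) by blast
        have "\<exists>L. s @ [prod_encode (y, prod_encode (k, L))] \<in> descent_tree" for k
          using below[OF less.prems(4) y(1)] y(2) lt less.prems descent_step_iff[of "last s" y k]
          by (simp add: descent_tree_snoc)
        then obtain s' where s': "s' \<in> level descent_tree m" "prefix s s'" "nfst (last s') = y"
          using extend[of s y m] less.prems(3) m False by fastforce
        have "rank_ge descent_tree \<delta> s'"
          using s' y less.prems m
          by (intro less.IH[OF \<delta>]) (auto simp: level_def prefix_def hd_append)
        then show ?thesis using s' by blast
      qed
    qed
  qed
  \<comment> \<open>The root has no last point; as its children may start anywhere in the order,
    \<alpha> takes the place of \<open>h x\<close>.\<close>
  have "rank_ge descent_tree \<gamma> [recf_code f]" if "\<gamma> \<le> \<alpha>" for \<gamma>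
    using that
  proof (induction \<gamma> rule: less_induct)
    case (less \<gamma>)
    show ?case
    proof (rule rank_geI)
      fix \<delta> m assume \<delta>: "\<delta> < \<gamma>" and m: "length [recf_code f] \<le> m"
      show "\<exists>s\<in>level descent_tree m. prefix [recf_code f] s \<and> rank_ge descent_tree \<delta> s"
      proof (cases "m = 1")
        case True
        then show ?thesis
          using less.IH[OF \<delta>] \<delta> less.prems
          by (intro bexI[of _ "[recf_code f]"]) (auto simp: level_def descent_tree_short)
      next
        case False
        have "\<delta> < \<alpha>" using \<delta> less.prems by simp
        then obtain y where y: "y \<in> Field r" "h y = \<delta>" using h(3) by blast
        obtain s where s: "s \<in> level descent_tree m" "prefix [recf_code f] s" "nfst (last s) = y"
          using extend[of "[recf_code f]" y m] m False by (auto simp: descent_tree_short)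
        then have "rank_ge descent_tree \<delta> s"
          using y m False by (intro nonroot) (auto simp: level_def prefix_def)
        then show ?thesis using s by blast
      qed
    qed
  qed
  then show ?thesis by simp
qed

end

theorem theorem3p8:
  shows "\<exists>T :: nat list set. computable_tree T \<and>
    scott_rank (tree_structure T) = ordinal_suc omega1_CK"
proof (intro exI conjI)
  show "computable_tree descent_tree" by (rule computable_descent_tree)
  show "scott_rank (tree_structure descent_tree) = ordinal_suc omega1_CK"
  proof (rule scott_rank_tree_structure[OF computable_descent_tree, of 1])
    fix \<beta> assume "\<beta> < omega1_CK"
    then obtain r :: "nat rel" and f where r: "Well_order r" "has_order_type r \<beta>"
        "\<And>z. evaluates f [z] (if z \<in> prod_encode ` r then 1 else 0)"
      unfolding less_omega1_CK_iff computable_ordinal_def computable_set_def by blast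
    have T: "[recf_code f] \<in> descent_tree" by (simp add: descent_tree_short)
    show "\<exists>t\<in>level descent_tree 1. rank_ge descent_tree \<beta> t \<and> \<not> rank_ge descent_tree omega1_CK t"
      using descent_tree_rank_ge[OF r(1,3,2)] T
        well_founded_rank_bound[OF computable_descent_tree T descent_tree_well_founded[OF r(1,3)]]
      by (intro bexI[of _ "[recf_code f]"]) (auto simp: level_def)
  qed
qed

end
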